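(* Let $\mathcal{K}$ be the class of convex functions on the unit disk, and for $n\ge 1$ set $$U_n=\sup_{f\in\mathcal{K}}\big(|a_{n+1}(f)|-|a_n(f)|\big),\qquad V_n=\sup_{f\in\mathcal{K}}\big(|a_n(f)|-|a_{n+1}(f)|\big).$$ Then: (i) $U_n=1/(n+1)$ for every $n\ge 2$, and the supremum is attained by $L_{\pi/n}$, i.e. $|a_{n+1}(L_{\pi/n})|-|a_n(L_{\pi/n})|=1/(n+1)$; (ii) $V_2=1/2$, attained by $L_{\pi/3}$; (iii) $V_3=1/3$, attained by $L_{\pi/4}$.
   Context: $\mathbb{D}=\{z\in\mathbb{C}:|z|<1\}$. $\mathcal{S}$ denotes the class of analytic univalent functions $f(z)=z+\sum_{n\ge2}a_nz^n$ on $\mathbb{D}$, and $a_n(f)$ denotes the $n$-th Taylor coefficient of $f$ (with $a_1=1$). $\mathcal{K}\subset\mathcal{S}$ is the class of convex functions, i.e. those $f\in\mathcal{S}$ with $f(\mathbb{D})$ convex. For $\phi\in\mathbb{R}$, $$L_\phi(z)=\frac{1}{e^{i\phi}-e^{-i\phi}}\log\frac{1-e^{-i\phi}z}{1-e^{i\phi}z}=\sum_{n=1}^\infty\frac{\sin n\phi}{n\sin\phi}z^n,$$ interpreted by continuity when $\sin\phi=0$ (e.g. $L_0(z)=z/(1-z)$); each $L_\phi$ belongs to $\mathcal{K}$. *)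

theory Defs
  imports "HOL-Analysis.Analysis"
begin

definition taylor_coeff :: "(complex \<Rightarrow> complex) \<Rightarrow> nat \<Rightarrow> complex" where
  "taylor_coeff f n = (deriv ^^ n) f 0 / of_nat (fact n)"

definition class_S :: "(complex \<Rightarrow> complex) set" where
  "class_S = {f. f holomorphic_on ball 0 1 \<and> inj_on f (ball 0 1) \<and> f 0 = 0 \<and> deriv f 0 = 1}"

definition class_K :: "(complex \<Rightarrow> complex) set" where
  "class_K = {f \<in> class_S. convex (f ` ball 0 1)}"

text \<open>Coefficients sin(n phi)/(n sin phi), extended by continuity when sin phi = 0\<close>
definition L_coeff :: "real \<Rightarrow> nat \<Rightarrow> real" where
  "L_coeff \<phi> n = (if sin \<phi> = 0 then cos ((real n - 1) * \<phi>)
                   else sin (real n * \<phi>) / (real n * sin \<phi>))"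

definition L :: "real \<Rightarrow> complex \<Rightarrow> complex" where
  "L \<phi> z = (\<Sum>k. complex_of_real (L_coeff \<phi> (Suc k)) * z ^ Suc k)"

end

theory Submission
  imports Defs "HOL-Complex_Analysis.Complex_Analysis"
begin

text \<open>
  For convex \<open>f\<close> put \<open>p = 1 + z f'' / f'\<close>, so that \<open>Re p \<ge> 0\<close>, and \<open>b\<^sub>n = n a\<^sub>n\<close>. Following Leung, there is a
  unimodular \<open>\<zeta>\<close> with \<open>\<Sum>k=1..n. (|p\<^sub>k - \<zeta>\<^sup>k|\<^sup>2 - 1) / k \<le> 0\<close>, and then the third Lebedev-Milin inequality
  for \<open>(1 - \<zeta> z) f'\<close> yields \<open>|b\<^sub>n\<^sub>+\<^sub>1 - \<zeta> b\<^sub>n| \<le> 1\<close>. Hence \<open>(n + 1) (|a\<^sub>n\<^sub>+\<^sub>1| - |a\<^sub>n|) \<le> 1 - |a\<^sub>n| \<le> 1\<close>.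

  For the bounds on the decrease, the Schur algorithm expresses \<open>a\<^sub>2, a\<^sub>3, a\<^sub>4\<close> through parameters in
  the unit disk. The bound on \<open>|a\<^sub>3| - |a\<^sub>4|\<close> follows by projecting \<open>b\<^sub>4\<close> on the direction of \<open>b\<^sub>3\<close>
  (after a rotation that makes \<open>a\<^sub>2\<close> nonnegative), which reduces the problem to one with real parameters.
\<close>

subsection \<open>The third Lebedev-Milin inequality\<close>

text \<open>The recursion is the coefficient form of z beta'(z) = a(z) beta(z), where a(z) sums A_k
  z^k over k >= 1. Cauchy-Schwarz bounds each coefficient by partial sums of squares, and 1 + x <=
  exp x turns this into exponential bounds, first for the partial sums \<open>B n\<close> and then
  for the single coefficient.\<close>

lemma lebedev_milin:
  fixes \<beta> A :: "nat \<Rightarrow> complex"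
  assumes \<beta>0: "\<beta> 0 = 1"
    and rec: "\<And>n. of_nat (Suc n) * \<beta> (Suc n) = (\<Sum>k\<le>n. A (Suc k) * \<beta> (n - k))"
  shows "(cmod (\<beta> (Suc n)))\<^sup>2 \<le> exp (\<Sum>k\<le>n. ((cmod (A (Suc k)))\<^sup>2 - 1) / real (Suc k))"
proof -
  define S where "S n = (\<Sum>k\<le>n. (cmod (A (Suc k)))\<^sup>2)" for n
  define B where "B n = (\<Sum>k\<le>n. (cmod (\<beta> k))\<^sup>2)" for n
  define E where "E n = (\<Sum>k<n. (S k - real (Suc k)) / (real (Suc k) * real (Suc (Suc k))))" for n
  have S_nonneg: "S n \<ge> 0" and B_nonneg: "B n \<ge> 0" for n
    by (auto simp: S_def B_def intro: sum_nonneg)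
  have step: "(real (Suc n))\<^sup>2 * (cmod (\<beta> (Suc n)))\<^sup>2 \<le> S n * B n" for n
  proof -
    have "real (Suc n) * cmod (\<beta> (Suc n)) = cmod (\<Sum>k\<le>n. A (Suc k) * \<beta> (n - k))"
      by (metis rec norm_mult norm_of_nat)
    also have "\<dots> \<le> (\<Sum>k\<le>n. cmod (A (Suc k)) * cmod (\<beta> (n - k)))"
      by (rule order_trans[OF norm_sum]) (simp add: norm_mult)
    finally have "(real (Suc n) * cmod (\<beta> (Suc n)))\<^sup>2
        \<le> (\<Sum>k\<le>n. cmod (A (Suc k)) * cmod (\<beta> (n - k)))\<^sup>2"
      by (intro power_mono) auto
    also have "\<dots> \<le> S n * (\<Sum>k\<le>n. (cmod (\<beta> (n - k)))\<^sup>2)"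
      unfolding S_def by (rule Cauchy_Schwarz_ineq_sum)
    also have "(\<Sum>k\<le>n. (cmod (\<beta> (n - k)))\<^sup>2) = B n"
      unfolding B_def by (rule sum.nat_diff_reindex[of "\<lambda>k. (cmod (\<beta> k))\<^sup>2" "Suc n", simplified lessThan_Suc_atMost diff_Suc_Suc])
    finally show ?thesis by (simp only: power_mult_distrib)
  qed
  have B_bound: "B n \<le> real (Suc n) * exp (E n)" for n
  proof (induction n)
    case 0
    show ?case by (simp add: B_def E_def \<beta>0)
  next
    case (Suc n)
    define m where "m = real (Suc n)"
    have m: "m > 0" by (simp add: m_def)
    define q where "q = (S n - m) / (m * (m + 1))"
    have "(cmod (\<beta> (Suc n)))\<^sup>2 \<le> S n * B n / m\<^sup>2"
      using step[of n] m by (simp add: m_def field_simps)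
    then have "B (Suc n) \<le> B n * (1 + S n / m\<^sup>2)"
      by (simp add: B_def algebra_simps)
    \<comment> \<open>Splitting off (m + 1) / m leaves \<open>1 + q\<close> for the exponential
      estimate; the split factors multiply up to the \<open>real (Suc n)\<close> in front of
      \<open>exp (E n)\<close>.\<close>
    also have "1 + S n / m\<^sup>2 = (m + 1) / m * (1 + q)"
    proof -
      have "m \<noteq> 0" "m + 1 \<noteq> 0" using m by auto
      then show ?thesis
        unfolding q_def power2_eq_square by (simp add: divide_simps) algebra
    qed
    also have "B n * ((m + 1) / m * (1 + q)) \<le> B n * ((m + 1) / m * exp q)"
      using m B_nonneg by (intro mult_left_mono exp_ge_add_one_self) auto
    also have "\<dots> \<le> (m * exp (E n)) * ((m + 1) / m * exp q)"
      using Suc m by (intro mult_right_mono) (auto simp: m_def)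
    also have "\<dots> = (m + 1) * exp (E n + q)"
      using m by (simp add: exp_add)
    also have "E n + q = E (Suc n)"
      by (simp add: E_def q_def m_def add_ac)
    finally show ?case by (simp add: m_def add_ac)
  qed
  \<comment> \<open>Summation by parts, since 1/((k+1)(k+2)) = 1/(k+1) - 1/(k+2). The boundary term
    \<open>S n / real (Suc n) - 1\<close> is the exponent that the final use of 1 + x <= exp x
    contributes.\<close>
  have exponent: "S n / real (Suc n) - 1 + E n
      = (\<Sum>k\<le>n. ((cmod (A (Suc k)))\<^sup>2 - 1) / real (Suc k))" for n
  proof (induction n)
    case 0
    show ?case by (simp add: S_def E_def)
  next
    case (Suc n)
    define m where "m = real (Suc n)"
    have m: "m > 0" by (simp add: m_def)
    have "S (Suc n) / (m + 1) - 1 + E (Suc n)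
        = (S n / m - 1 + E n) + ((cmod (A (Suc (Suc n))))\<^sup>2 - 1) / (m + 1)"
    proof -
      have "E (Suc n) = E n + (S n - m) / (m * (m + 1))"
        by (simp add: E_def m_def add_ac)
      moreover have "S (Suc n) = S n + (cmod (A (Suc (Suc n))))\<^sup>2"
        by (simp add: S_def)
      moreover have "m \<noteq> 0" "m + 1 \<noteq> 0" using m by auto
      then have "(S n + a) / (m + 1) - 1 + (e + (S n - m) / (m * (m + 1)))
        = S n / m - 1 + e + (a - 1) / (m + 1)" for a e
        by (simp add: divide_simps) algebra
      ultimately show ?thesis by simp
    qed
    with Suc show ?case by (simp add: m_def add_ac)
  qed
  define m where "m = real (Suc n)"
  have m: "m > 0" by (simp add: m_def)
  have "(cmod (\<beta> (Suc n)))\<^sup>2 \<le> S n * B n / m\<^sup>2"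
    using step[of n] m by (simp add: m_def field_simps)
  also have "\<dots> \<le> S n * (m * exp (E n)) / m\<^sup>2"
    using B_bound[of n] S_nonneg by (intro divide_right_mono mult_left_mono) (auto simp: m_def)
  also have "\<dots> = S n / m * exp (E n)"
    using m by (simp add: power2_eq_square)
  also have "\<dots> \<le> exp (S n / m - 1) * exp (E n)"
    using exp_ge_add_one_self[of "S n / m - 1"] by (intro mult_right_mono) auto
  also have "\<dots> = exp (S n / m - 1 + E n)"
    by (simp add: exp_add)
  finally show ?thesis
    using exponent[of n] by (simp only: m_def)
qed

subsection \<open>Functions with nonnegative real part\<close>

text \<open>Cauchy's formula for the k-th derivative at 0, written in the angle. With r < 1 the
  closed disk lies inside the domain, so no boundary values of \<open>q\<close> are
  involved.\<close>

lemma circle_coefficient_integral: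
  fixes r :: real
  assumes holo: "q holomorphic_on ball 0 1" and r: "0 < r" "r < 1"
  shows "((\<lambda>t. q (r * cis t) * cis (- (real k * t))) has_integral
      2 * pi * r ^ k * fps_nth (fps_expansion q 0) k) {0..2 * pi}"
proof -
  have "((\<lambda>u. q u / (u - 0) ^ Suc k) has_contour_integral (2 * pi * \<i> / fact k) * (deriv ^^ k) q 0)
      (circlepath 0 r)"
    using r by (intro Cauchy_has_contour_integral_higher_derivative_circlepath)
      (auto intro!: holomorphic_on_imp_continuous_on holomorphic_on_subset[OF holo])
  then have "((\<lambda>t. q (0 + r * cis t) / (0 + r * cis t - 0) ^ Suc k * r * \<i> * cis t) has_integral
      (2 * pi * \<i> / fact k) * (deriv ^^ k) q 0) {0..2 * pi}"
    unfolding circlepath_def by (subst (asm) has_contour_integral_part_circlepath_iff) auto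
  \<comment> \<open>The factor r^k / i turns the kernel dz / z^(k+1) into cis (-kt) dt.\<close>
  then have "((\<lambda>t. (r ^ k / \<i>) * (q (0 + r * cis t) / (0 + r * cis t - 0) ^ Suc k * r * \<i> * cis t)) has_integral
      (r ^ k / \<i>) * ((2 * pi * \<i> / fact k) * (deriv ^^ k) q 0)) {0..2 * pi}"
    by (rule has_integral_mult_right)
  moreover have "(r ^ k / \<i>) * (q (0 + r * cis t) / (0 + r * cis t - 0) ^ Suc k * r * \<i> * cis t)
      = q (r * cis t) * cis (- (real k * t))" for t
  proof -
    have "cis (- (real k * t)) = inverse (cis t ^ k)"
      by (simp add: Complex.DeMoivre)
    then show ?thesis using r by (simp add: power_mult_distrib field_simps)
  qed
  ultimately show ?thesis by (simp add: fps_expansion_def mult_ac)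
qed

text \<open>Up to a constant this is the zeroth coefficient of q(z) z^(k+1), which vanishes at 0: a
  holomorphic function has no negative frequencies.\<close>

lemma circle_moment_integral:
  fixes r :: real
  assumes holo: "q holomorphic_on ball 0 1" and r: "0 < r" "r < 1"
  shows "((\<lambda>t. q (r * cis t) * cis (real (Suc k) * t)) has_integral 0) {0..2 * pi}"
proof -
  have "(\<lambda>z. q z * z ^ Suc k) holomorphic_on ball 0 1"
    by (intro holomorphic_intros holo)
  from circle_coefficient_integral[OF this r, of 0]
  have "((\<lambda>t. q (r * cis t) * (r * cis t) ^ Suc k) has_integral 0) {0..2 * pi}"
    by (simp add: fps_expansion_def)
  from has_integral_mult_right[OF this, of "inverse (of_real (r ^ Suc k))"]
  show ?thesis using r by (simp add: power_mult_distrib Complex.DeMoivre field_simps flip: power_Suc)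
qed

text \<open>Averaging \<open>Re (p (r w)) * (M - T w)\<close> over the circle, where \<open>M\<close> is the maximum of
  \<open>T w = Re (\<Sum>k. p\<^sub>k w ^ k / k)\<close>, and letting \<open>r\<close> tend to \<open>1\<close>; the maximum point is \<open>cnj \<zeta>\<close>.\<close>
lemma caratheodory_rotation:
  fixes n :: nat
  assumes holo: "p holomorphic_on ball 0 1" and re: "\<And>z. cmod z < 1 \<Longrightarrow> Re (p z) \<ge> 0" and p0: "p 0 = 1"
  defines "c \<equiv> fps_nth (fps_expansion p 0)"
  obtains \<zeta> where "cmod \<zeta> = 1"
    "(\<Sum>k\<le>n. ((cmod (c (Suc k) - \<zeta> ^ Suc k))\<^sup>2 - 1) / real (Suc k)) \<le> 0"
proof -
  define T where "T w = (\<Sum>k\<le>n. Re (c (Suc k) * w ^ Suc k) / real (Suc k))" for w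
  have "continuous_on (sphere 0 1) T"
    unfolding T_def by (intro continuous_intros) auto
  then obtain w where w: "cmod w = 1" "\<And>v. cmod v = 1 \<Longrightarrow> T v \<le> T w"
    using continuous_attains_sup[of "sphere (0::complex) 1" T] by auto
  have ineq: "(\<Sum>k\<le>n. (cmod (c (Suc k)))\<^sup>2 * r ^ Suc k / real (Suc k)) \<le> 2 * T w" if r: "0 < r" "r < 1" for r
  proof -
    have intT: "((\<lambda>t. Re (p (r * cis t)) * (Re (c (Suc k) * cis t ^ Suc k) / real (Suc k))) has_integral
        pi * ((cmod (c (Suc k)))\<^sup>2 * r ^ Suc k / real (Suc k))) {0..2 * pi}" for k
    proof -
      \<comment> \<open>With v = \<open>c (Suc k) * cis t ^ Suc k\<close> one has Re p Re v = Re (p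
        v + p cnj v) / 2. The first product integrates to zero, the second picks out the coefficient
        \<open>c (Suc k)\<close>.\<close>
      have "((\<lambda>t. c (Suc k) * (p (r * cis t) * cis (real (Suc k) * t))
          + cnj (c (Suc k)) * (p (r * cis t) * cis (- (real (Suc k) * t)))) has_integral
          c (Suc k) * 0 + cnj (c (Suc k)) * (2 * pi * r ^ Suc k * c (Suc k))) {0..2 * pi}"
        unfolding c_def
        by (intro has_integral_add has_integral_mult_right circle_moment_integral
            circle_coefficient_integral holo r)
      then have "((\<lambda>t. Re (c (Suc k) * (p (r * cis t) * cis (real (Suc k) * t))
          + cnj (c (Suc k)) * (p (r * cis t) * cis (- (real (Suc k) * t)))) / (2 * real (Suc k))) has_integral
          Re (c (Suc k) * 0 + cnj (c (Suc k)) * (2 * pi * r ^ Suc k * c (Suc k))) / (2 * real (Suc k))) {0..2 * pi}"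
        by (intro has_integral_divide has_integral_Re)
      moreover have "Re (c (Suc k) * (p (r * cis t) * cis (real (Suc k) * t))
          + cnj (c (Suc k)) * (p (r * cis t) * cis (- (real (Suc k) * t)))) / (2 * real (Suc k))
        = Re (p (r * cis t)) * (Re (c (Suc k) * cis t ^ Suc k) / real (Suc k))" for t
        by (simp only: Complex.DeMoivre) (simp add: field_simps del: of_nat_Suc)
      moreover have "Re (c (Suc k) * 0 + cnj (c (Suc k)) * (2 * pi * r ^ Suc k * c (Suc k))) / (2 * real (Suc k))
        = pi * ((cmod (c (Suc k)))\<^sup>2 * r ^ Suc k / real (Suc k))"
      proof -
        have "cnj (c (Suc k)) * (2 * pi * r ^ Suc k * c (Suc k)) = of_real (2 * pi * r ^ Suc k * (cmod (c (Suc k)))\<^sup>2)"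
          unfolding of_real_mult complex_norm_square by simp
        then show ?thesis by (simp del: of_nat_Suc of_real_mult power_Suc)
      qed
      ultimately show ?thesis by simp
    qed
    have "((\<lambda>t. Re (p (r * cis t) * cis (- (real 0 * t)))) has_integral
        Re (2 * pi * r ^ 0 * fps_nth (fps_expansion p 0) 0)) {0..2 * pi}"
      by (intro has_integral_Re circle_coefficient_integral holo r)
    then have "((\<lambda>t. Re (p (r * cis t))) has_integral 2 * pi) {0..2 * pi}"
      by (simp add: fps_expansion_def p0)
    then have "((\<lambda>t. Re (p (r * cis t)) * T w - (\<Sum>k\<le>n. Re (p (r * cis t)) * (Re (c (Suc k) * cis t ^ Suc k) / real (Suc k))))
      has_integral 2 * pi * T w - (\<Sum>k\<le>n. pi * ((cmod (c (Suc k)))\<^sup>2 * r ^ Suc k / real (Suc k)))) {0..2 * pi}"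
      by (intro has_integral_diff has_integral_sum has_integral_mult_left intT) auto
    moreover have "Re (p (r * cis t)) * T w - (\<Sum>k\<le>n. Re (p (r * cis t)) * (Re (c (Suc k) * cis t ^ Suc k) / real (Suc k))) \<ge> 0" for t
    proof -
      have "Re (p (r * cis t)) * (T w - T (cis t)) \<ge> 0"
        using r w(2)[of "cis t"] by (intro mult_nonneg_nonneg re) (auto simp: norm_mult)
      then show ?thesis by (simp add: T_def sum_distrib_left right_diff_distrib)
    qed
    ultimately have "2 * pi * T w - (\<Sum>k\<le>n. pi * ((cmod (c (Suc k)))\<^sup>2 * r ^ Suc k / real (Suc k))) \<ge> 0"
      by (rule has_integral_nonneg)
    then have "pi * (\<Sum>k\<le>n. (cmod (c (Suc k)))\<^sup>2 * r ^ Suc k / real (Suc k)) \<le> pi * (2 * T w)"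
      by (simp add: sum_distrib_left)
    then show ?thesis by (simp only: mult_le_cancel_left_pos pi_gt_zero)
  qed
  have "((\<lambda>r. \<Sum>k\<le>n. (cmod (c (Suc k)))\<^sup>2 * r ^ Suc k / real (Suc k)) \<longlongrightarrow>
      (\<Sum>k\<le>n. (cmod (c (Suc k)))\<^sup>2 * 1 ^ Suc k / real (Suc k))) (at_left 1)"
    by (intro tendsto_intros) auto
  moreover have "eventually (\<lambda>r::real. 0 < r \<and> r < 1) (at_left 1)"
    using eventually_at_left_real[of 0 "1::real"] by (auto elim: eventually_mono)
  then have "eventually (\<lambda>r. (\<Sum>k\<le>n. (cmod (c (Suc k)))\<^sup>2 * r ^ Suc k / real (Suc k)) \<le> 2 * T w) (at_left 1)"
    by eventually_elim (use ineq in blast)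
  ultimately have lim: "(\<Sum>k\<le>n. (cmod (c (Suc k)))\<^sup>2 / real (Suc k)) \<le> 2 * T w"
    using tendsto_upperbound[of _ _ "at_left (1::real)"] by simp
  \<comment> \<open>As \<open>w\<close> is unimodular, the 1 cancels when the square is expanded;
    the sum to be bounded is then the left side of \<open>lim\<close> minus its right side.\<close>
  have sq: "(cmod (a - cnj w ^ k))\<^sup>2 - 1 = (cmod a)\<^sup>2 - 2 * Re (a * w ^ k)" for a k
  proof -
    define v where "v = w ^ k"
    have "cmod v = 1" using w(1) by (simp add: v_def norm_power)
    then have "(Re v)\<^sup>2 + (Im v)\<^sup>2 = 1" by (simp flip: cmod_power2)
    moreover have "(cmod (a - cnj v))\<^sup>2 - 1 = (cmod a)\<^sup>2 - 2 * Re (a * v) + ((Re v)\<^sup>2 + (Im v)\<^sup>2 - 1)"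
      unfolding cmod_power2 by (simp add: power2_eq_square algebra_simps)
    ultimately show ?thesis by (simp add: v_def)
  qed
  have "(\<Sum>k\<le>n. ((cmod (c (Suc k) - cnj w ^ Suc k))\<^sup>2 - 1) / real (Suc k))
      = (\<Sum>k\<le>n. (cmod (c (Suc k)))\<^sup>2 / real (Suc k)) - 2 * T w"
    unfolding sq T_def by (simp add: sum_subtractf sum_distrib_left diff_divide_distrib del: of_nat_Suc)
  then show ?thesis
    using lim w(1) by (intro that[of "cnj w"]) auto
qed

text \<open>One step of the Schur algorithm: the Moebius map moving \<open>F 0\<close> to 0 makes
  the Schwarz lemma applicable, which allows division by z. The product form also covers a constant
  \<open>F\<close> of modulus 1, where the Moebius denominator would vanish and \<open>G = 0\<close>
  serves.\<close>

lemma schur_step: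
  assumes holo: "F holomorphic_on ball 0 1" and bound: "\<And>z. cmod z < 1 \<Longrightarrow> cmod (F z) \<le> 1"
  obtains G where "G holomorphic_on ball 0 1" "\<And>z. cmod z < 1 \<Longrightarrow> cmod (G z) \<le> 1"
    "\<And>z. cmod z < 1 \<Longrightarrow> F z - F 0 = z * G z * (1 - cnj (F 0) * F z)"
proof (cases "\<exists>w. cmod w < 1 \<and> cmod (F w) = 1")
  case True
  then obtain w where w: "cmod w < 1" "cmod (F w) = 1" by blast
  have "F constant_on ball 0 1"
    using w bound by (intro maximum_modulus_principle[where U = "ball 0 1" and \<xi> = w] holo) auto
  then obtain a where "\<And>z. cmod z < 1 \<Longrightarrow> F z = a"
    by (auto simp: constant_on_def)
  then have const: "F z = F 0" if "cmod z < 1" for z using that by simp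
  show ?thesis
  proof (rule that[of "\<lambda>_. 0"])
    show "F z - F 0 = z * 0 * (1 - cnj (F 0) * F z)" if "cmod z < 1" for z
      by (simp add: const[OF that])
  qed auto
next
  case False
  then have lt: "cmod (F z) < 1" if "cmod z < 1" for z
    using bound[OF that] that by force
  define M where "M z = Moebius_function 0 (F 0) (F z)" for z
  have F0: "cmod (F 0) < 1" by (rule lt) simp
  have holM: "M holomorphic_on ball 0 1"
    using holomorphic_on_compose_gen[OF holo Moebius_function_holomorphic[OF F0], of 0] lt
    unfolding M_def o_def by (simp add: image_subset_iff)
  have M0: "M 0 = 0" by (simp add: M_def Moebius_function_eq_zero)
  have M1: "cmod (M z) < 1" if "cmod z < 1" for z
    unfolding M_def by (intro Moebius_function_norm_lt_1 F0 lt that)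
  obtain G where G: "G holomorphic_on ball 0 1" "\<And>z. cmod z < 1 \<Longrightarrow> M z = z * G z" "deriv M 0 = G 0"
    using Schwarz3[OF holM M0] by metis
  show ?thesis
  proof (rule that[OF G(1)])
    fix z :: complex assume z: "cmod z < 1"
    show "cmod (G z) \<le> 1"
    proof (cases "z = 0")
      case True
      then show ?thesis using Schwarz_Lemma(2)[OF holM M0 M1 z] G(3) by simp
    next
      case False
      have "cmod z * cmod (G z) \<le> cmod z * 1"
        using Schwarz_Lemma(1)[OF holM M0 M1 z] G(2)[OF z] by (simp add: norm_mult)
      then show ?thesis using False by (simp only: mult_le_cancel_left) auto
    qed
    have "cmod (cnj (F 0) * F z) < 1"
      using F0 lt[OF z] norm_mult_less[of "cnj (F 0)" 1 "F z" 1] by simp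
    then have "1 - cnj (F 0) * F z \<noteq> 0" by auto
    then show "F z - F 0 = z * G z * (1 - cnj (F 0) * F z)"
      using G(2)[OF z] by (simp add: M_def Moebius_function_simple divide_simps)
  qed
qed

lemma holomorphic_has_fps_expansion_0:
  assumes "f holomorphic_on ball 0 1"
  shows "f has_fps_expansion fps_expansion f 0"
  using assms by (intro has_fps_expansion_fps_expansion[of "ball 0 1"]) auto

lemma eq_on_ball_imp_fps_eq:
  fixes f g :: "complex \<Rightarrow> complex"
  assumes "f has_fps_expansion F" "g has_fps_expansion G" "\<And>z. cmod z < 1 \<Longrightarrow> f z = g z"
  shows "F = G"
proof -
  have "eventually (\<lambda>z. z \<in> ball 0 1) (nhds (0::complex))"
    by (intro eventually_nhds_in_open) auto
  then have "eventually (\<lambda>z. f z = g z) (nhds 0)"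
    by eventually_elim (use assms(3) in auto)
  then have "f has_fps_expansion F \<longleftrightarrow> g has_fps_expansion F"
    by (intro has_fps_expansion_cong refl)
  with assms(1,2) show ?thesis
    by (metis fps_expansion_unique_complex)
qed

text \<open>The Cayley transform (p - 1)/(p + 1) maps into the closed disk and vanishes at 0. Three
  Schur steps produce \<open>G\<close>, \<open>H\<close> and \<open>K\<close>, and \<open>g\<close>,
  \<open>x\<close>, \<open>y\<close> are their values at 0.\<close>

lemma caratheodory_coeffs:
  assumes holo: "p holomorphic_on ball 0 1" and re: "\<And>z. cmod z < 1 \<Longrightarrow> Re (p z) \<ge> 0" and p0: "p 0 = 1"
  obtains g x y :: complex where "cmod g \<le> 1" "cmod x \<le> 1" "cmod y \<le> 1"
    "fps_nth (fps_expansion p 0) 1 = 2 * g"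
    "fps_nth (fps_expansion p 0) 2 = 2 * g\<^sup>2 + 2 * (1 - (cmod g)\<^sup>2) * x"
    "fps_nth (fps_expansion p 0) 3 = 2 * g ^ 3 + 4 * (1 - (cmod g)\<^sup>2) * g * x
       + 2 * (1 - (cmod g)\<^sup>2) * ((1 - (cmod x)\<^sup>2) * y - cnj g * x\<^sup>2)"
proof -
  define F where "F z = (p z - 1) / (p z + 1)" for z
  have nz: "p z + 1 \<noteq> 0" if "cmod z < 1" for z
  proof
    assume "p z + 1 = 0"
    then have "Re (p z + 1) = 0" by simp
    with re[OF that] show False by simp
  qed
  have holF: "F holomorphic_on ball 0 1"
    unfolding F_def by (intro holomorphic_intros holo) (use nz in auto)
  have F1: "cmod (F z) \<le> 1" if "cmod z < 1" for z
  proof -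
    have "(cmod (p z - 1))\<^sup>2 \<le> (cmod (p z + 1))\<^sup>2"
      using re[OF that] unfolding cmod_power2 by (simp add: power2_eq_square algebra_simps)
    then have "cmod (p z - 1) \<le> cmod (p z + 1)" by (rule power2_le_imp_le) simp
    then show ?thesis using nz[OF that] by (simp add: F_def norm_divide)
  qed
  have F0: "F 0 = 0" by (simp add: F_def p0)
  obtain G where G: "G holomorphic_on ball 0 1" "\<And>z. cmod z < 1 \<Longrightarrow> cmod (G z) \<le> 1"
    "\<And>z. cmod z < 1 \<Longrightarrow> F z = z * G z"
    using schur_step[OF holF F1] F0 by (metis complex_cnj_zero diff_zero mult.right_neutral mult_zero_left)
  obtain H where H: "H holomorphic_on ball 0 1" "\<And>z. cmod z < 1 \<Longrightarrow> cmod (H z) \<le> 1"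
    "\<And>z. cmod z < 1 \<Longrightarrow> G z - G 0 = z * H z * (1 - cnj (G 0) * G z)"
    using schur_step[OF G(1,2)] by metis
  obtain K where K: "K holomorphic_on ball 0 1" "\<And>z. cmod z < 1 \<Longrightarrow> cmod (K z) \<le> 1"
    "\<And>z. cmod z < 1 \<Longrightarrow> H z - H 0 = z * K z * (1 - cnj (H 0) * H z)"
    using schur_step[OF H(1,2)] by metis
  let ?e = "\<lambda>f. fps_expansion f (0::complex)"
  note ex = holo[THEN holomorphic_has_fps_expansion_0] G(1)[THEN holomorphic_has_fps_expansion_0]
    H(1)[THEN holomorphic_has_fps_expansion_0] K(1)[THEN holomorphic_has_fps_expansion_0]
  \<comment> \<open>The relations between \<open>p\<close>, \<open>G\<close>, \<open>H\<close>,
    \<open>K\<close> pass to formal power series without division, so low coefficients can be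
    compared one after the other.\<close>
  have ps: "?e p * (1 - fps_X * ?e G) = 1 + fps_X * ?e G"
  proof (rule eq_on_ball_imp_fps_eq)
    show "(\<lambda>z. p z * (1 - z * G z)) has_fps_expansion ?e p * (1 - fps_X * ?e G)"
      by (intro fps_expansion_intros ex)
    show "(\<lambda>z. 1 + z * G z) has_fps_expansion 1 + fps_X * ?e G"
      by (intro fps_expansion_intros ex)
    fix z :: complex assume z: "cmod z < 1"
    have "z * G z * (p z + 1) = p z - 1" using G(3)[OF z] nz[OF z] by (simp add: F_def divide_simps)
    then show "p z * (1 - z * G z) = 1 + z * G z" by algebra
  qed
  have Gs: "?e G - fps_const (G 0) = fps_X * ?e H * (1 - fps_const (cnj (G 0)) * ?e G)"
  proof (rule eq_on_ball_imp_fps_eq)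
    show "(\<lambda>z. G z - G 0) has_fps_expansion ?e G - fps_const (G 0)"
      by (intro fps_expansion_intros ex)
    show "(\<lambda>z. z * H z * (1 - cnj (G 0) * G z)) has_fps_expansion
        fps_X * ?e H * (1 - fps_const (cnj (G 0)) * ?e G)"
      by (intro fps_expansion_intros ex)
  qed (rule H(3))
  have Hs: "?e H - fps_const (H 0) = fps_X * ?e K * (1 - fps_const (cnj (H 0)) * ?e H)"
  proof (rule eq_on_ball_imp_fps_eq)
    show "(\<lambda>z. H z - H 0) has_fps_expansion ?e H - fps_const (H 0)"
      by (intro fps_expansion_intros ex)
    show "(\<lambda>z. z * K z * (1 - cnj (H 0) * H z)) has_fps_expansion
        fps_X * ?e K * (1 - fps_const (cnj (H 0)) * ?e H)"
      by (intro fps_expansion_intros ex)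
  qed (rule K(3))
  have at0: "fps_nth (?e f) 0 = f 0" for f by (simp add: fps_expansion_def)
  \<comment> \<open>Written with conjugates rather than moduli, so that the coefficient comparison
    is purely polynomial; \<open>de\<close> restores the moduli at the end.\<close>
  define d where "d = 1 - G 0 * cnj (G 0)"
  define e where "e = 1 - H 0 * cnj (H 0)"
  let ?n = "\<lambda>f. fps_nth (?e f)"
  have "?n H 1 = K 0 * (1 - cnj (H 0) * H 0)"
    using arg_cong[OF Hs, of "\<lambda>f. fps_nth f 1"] by (simp add: fps_mult_nth numeral_eq_Suc at0)
  then have H1: "?n H 1 = K 0 * e" by (simp add: e_def mult.commute)
  have "?n G 1 = H 0 * (1 - cnj (G 0) * G 0)"
    using arg_cong[OF Gs, of "\<lambda>f. fps_nth f 1"] by (simp add: fps_mult_nth numeral_eq_Suc at0)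
  then have G1: "?n G 1 = H 0 * d" by (simp add: d_def mult.commute)
  have "?n G 2 = ?n H 1 * (1 - cnj (G 0) * G 0) - H 0 * cnj (G 0) * ?n G 1"
    using arg_cong[OF Gs, of "\<lambda>f. fps_nth f 2"] by (simp add: fps_mult_nth numeral_eq_Suc at0)
  then have G2: "?n G 2 = K 0 * e * d - H 0 * cnj (G 0) * (H 0 * d)"
    unfolding H1 G1 by (simp add: d_def mult.commute)
  have "?n p 1 - G 0 = G 0"
    using arg_cong[OF ps, of "\<lambda>f. fps_nth f 1"] by (simp add: fps_mult_nth numeral_eq_Suc at0 p0)
  then have p1: "?n p 1 = 2 * G 0" by simp
  have "?n p 2 - ?n p 1 * G 0 - ?n G 1 = ?n G 1"
    using arg_cong[OF ps, of "\<lambda>f. fps_nth f 2"] by (simp add: fps_mult_nth numeral_eq_Suc at0 p0)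
  then have p2: "?n p 2 = 2 * (G 0)\<^sup>2 + 2 * (H 0 * d)"
    unfolding p1 G1 by algebra
  have "?n p 3 - ?n p 2 * G 0 - ?n p 1 * ?n G 1 - ?n G 2 = ?n G 2"
    using arg_cong[OF ps, of "\<lambda>f. fps_nth f 3"] by (simp add: fps_mult_nth numeral_eq_Suc at0 p0)
  then have p3: "?n p 3 = 2 * (G 0) ^ 3 + 4 * d * G 0 * H 0 + 2 * d * (e * K 0 - cnj (G 0) * (H 0)\<^sup>2)"
    unfolding p1 G1 p2 G2 by (simp add: algebra_simps power2_eq_square power3_eq_cube)
  have de: "d = 1 - of_real ((cmod (G 0))\<^sup>2)" "e = 1 - of_real ((cmod (H 0))\<^sup>2)"
    unfolding d_def e_def complex_norm_square by simp_all
  show ?thesis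
  proof (rule that[of "G 0" "H 0" "K 0"])
    show "cmod (G 0) \<le> 1" "cmod (H 0) \<le> 1" "cmod (K 0) \<le> 1"
      using G(2)[of 0] H(2)[of 0] K(2)[of 0] by simp_all
    show "?n p 1 = 2 * G 0" by (rule p1)
    show "?n p 2 = 2 * (G 0)\<^sup>2 + 2 * (1 - (cmod (G 0))\<^sup>2) * H 0"
      using p2 unfolding de by simp
    show "?n p 3 = 2 * G 0 ^ 3 + 4 * (1 - (cmod (G 0))\<^sup>2) * G 0 * H 0
        + 2 * (1 - (cmod (G 0))\<^sup>2) * ((1 - (cmod (H 0))\<^sup>2) * K 0 - cnj (G 0) * (H 0)\<^sup>2)"
      using p3 unfolding de by simp
  qed
qed

subsection \<open>The extremal problem for the third and fourth coefficient\<close>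

text \<open>The quadratic is convex in x and increasing on the admissible range, so its left
  endpoint decides. This endpoint is -1 if 2c^2 >= 1, and otherwise the solution of 3c^2 + (1 - c^2)
  x = 1; at either one the value factors into nonnegative terms.\<close>

lemma third_fourth_coeff_inequality_real:
  fixes c x :: real
  assumes c: "0 \<le> c" "c < 1" and x: "-1 \<le> x" and u: "1 \<le> 3 * c\<^sup>2 + (1 - c\<^sup>2) * x"
  shows "0 \<le> 1 - 5 * c\<^sup>2 + 6 * c ^ 3 + (1 - c\<^sup>2) * ((5 * c - 2) * x + (1 - c) * x\<^sup>2)"
    (is "0 \<le> ?h x")
proof -
  define d where "d = 1 - c\<^sup>2"
  have d: "d > 0" using c by (simp add: d_def power_less_one_iff abs_square_less_1)
  have diff: "?h x - ?h a = d * (x - a) * ((5 * c - 2) + (1 - c) * (x + a))" for a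
    unfolding d_def by algebra
  show ?thesis
  proof (cases "2 * c\<^sup>2 \<ge> 1")
    case True
    \<comment> \<open>Since 1/sqrt 2 > 2/3. This makes both the slope factor, at least 7c - 4, and
      the factor 3c - 2 of the endpoint value positive.\<close>
    have c23: "c > 2/3"
    proof (rule ccontr)
      assume "\<not> c > 2/3"
      then have "c\<^sup>2 \<le> (2/3)\<^sup>2" using c by (intro power_mono) auto
      with True show False by (simp add: power2_eq_square)
    qed
    have "(1 - c) * (x + (-1)) \<ge> (1 - c) * (-2)"
      using c x by (intro mult_left_mono) auto
    then have "(5 * c - 2) + (1 - c) * (x + (-1)) \<ge> 0" using c23 by (simp add: algebra_simps)
    then have "?h x - ?h (-1) \<ge> 0"
      unfolding diff using d x by (intro mult_nonneg_nonneg) auto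
    moreover have "?h (-1) = 2 * (2 * c\<^sup>2 - 1) * (3 * c - 2)" by algebra
    moreover have "\<dots> \<ge> 0" using True c23 by (intro mult_nonneg_nonneg) auto
    ultimately show ?thesis by linarith
  next
    case False
    define a where "a = (1 - 3 * c\<^sup>2) / d"
    have da: "d * a = 1 - 3 * c\<^sup>2" using d by (simp add: a_def)
    have ax: "a \<le> x" using u d by (simp add: a_def d_def field_simps)
    \<comment> \<open>Multiplying by \<open>d\<close> clears the denominator of \<open>a\<close>:
      this is the sign of the derivative at the endpoint.\<close>
    have "d * (5 * c - 2) + (1 - c) * (2 * (d * a)) = c * (3 - c) * (1 - c)"
      unfolding da unfolding d_def by algebra
    also have "\<dots> \<ge> 0" using c by auto
    finally have "d * ((5 * c - 2) + (1 - c) * (2 * a)) \<ge> 0" by (simp add: algebra_simps)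
    then have "(5 * c - 2) + (1 - c) * (2 * a) \<ge> 0"
      using d by (simp add: zero_le_mult_iff)
    moreover have "(1 - c) * (x + a) \<ge> (1 - c) * (2 * a)"
      using c ax by (intro mult_left_mono) auto
    ultimately have "?h x - ?h a \<ge> 0"
      unfolding diff using d ax by (intro mult_nonneg_nonneg) auto
    moreover have "d * ?h a = d * (1 - 5 * c\<^sup>2 + 6 * c ^ 3)
        + d * ((5 * c - 2) * (d * a)) + (1 - c) * (d * a)\<^sup>2"
      unfolding d_def by algebra
    then have "d * ?h a = 4 * c * (1 - 2 * c\<^sup>2) * (1 - c)"
      unfolding da unfolding d_def by algebra
    then have "d * ?h a \<ge> 0" using c False by simp
    then have "?h a \<ge> 0"
      using d by (simp only: zero_le_mult_iff) auto
    ultimately show ?thesis by linarith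
  qed
qed

text \<open>In the parameters of \<open>convex_initial_coeffs\<close> the two norms are 3|a_3| and
  12|a_4|, so this is |a_3| - |a_4| <= 1/3. The right-hand norm is bounded below by its component
  along \<open>u\<close>.\<close>

lemma third_fourth_coeff_inequality:
  fixes c d :: real and x y u :: complex
  assumes c: "0 \<le> c" "c \<le> 1" and x: "cmod x \<le> 1" and y: "cmod y \<le> 1"
  defines "d \<equiv> 1 - c\<^sup>2" and "u \<equiv> 3 * c\<^sup>2 + (1 - c\<^sup>2) * x"
  shows "4 * cmod u - 4 \<le> cmod (4 * c * u + 2 * d * (c * x * (3 - x) + (1 - (cmod x)\<^sup>2) * y))"
proof (cases "cmod u \<le> 1 \<or> c = 1")
  case True
  then show ?thesis
  proof
    assume "cmod u \<le> 1"
    then show ?thesis by (smt (verit) norm_ge_zero)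
  next
    assume "c = 1"
    then show ?thesis by (simp add: d_def u_def)
  qed
next
  case False
  then have U1: "cmod u > 1" and c1: "c < 1" using c by auto
  define U t s where "U = cmod u" and "t = Re x" and "s = (cmod x)\<^sup>2"
  have d: "d > 0" using c c1 by (simp add: d_def power_less_one_iff abs_square_less_1)
  have s1: "s \<le> 1" using x by (simp add: s_def power_le_one)
  have U1': "U > 1" using U1 by (simp add: U_def)
  define R where "R = Re (x * (3 - x) * cnj u)"
  have xs: "(Re x)\<^sup>2 + (Im x)\<^sup>2 = s"
    by (simp add: s_def cmod_power2)
  have Usq: "U\<^sup>2 = 9 * c ^ 4 + 6 * c\<^sup>2 * d * t + d\<^sup>2 * s"
  proof -
    have "U\<^sup>2 = (3 * c\<^sup>2 + d * Re x)\<^sup>2 + (d * Im x)\<^sup>2"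
      by (simp add: U_def cmod_power2 u_def d_def)
    then show ?thesis unfolding xs[symmetric] t_def by algebra
  qed
  have Rval: "R = 9 * c\<^sup>2 * t - 6 * c\<^sup>2 * t\<^sup>2 + 3 * c\<^sup>2 * s + d * s * (3 - t)"
  proof -
    have "R = (Re x * (3 - Re x) + (Im x)\<^sup>2) * (3 * c\<^sup>2 + d * Re x)
            + (Im x * (3 - Re x) - Re x * Im x) * (d * Im x)"
      by (simp add: R_def u_def d_def algebra_simps power2_eq_square)
    then show ?thesis unfolding xs[symmetric] t_def by algebra
  qed
  have tU: "d * t \<le> U - 3 * c\<^sup>2"
  proof -
    have "Re u \<le> U" unfolding U_def by (rule complex_Re_le_cmod)
    then show ?thesis by (simp add: u_def d_def t_def)
  qed
  \<comment> \<open>The real value that, put in place of \<open>x\<close>, gives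
    \<open>u = U\<close>; it bounds \<open>t\<close> from above because Re u <= |u|.\<close>
  define x' where "x' = (U - 3 * c\<^sup>2) / d"
  have dx': "d * x' = U - 3 * c\<^sup>2" using d by (simp add: x'_def)
  have tx': "t \<le> x'" using tU d by (simp add: x'_def field_simps)
  have x'1: "-1 \<le> x'"
  proof -
    have "- t \<le> 1" using x abs_Re_le_cmod[of x] unfolding t_def by linarith
    then show ?thesis using tx' by linarith
  qed
  text \<open>At fixed modulus \<open>U\<close> the quantity \<open>Q\<close> is affine and decreasing in \<open>t\<close>, so the worst
    case is the largest admissible value of \<open>t\<close>, where \<open>u\<close> is a positive real number.\<close>
  define Q where "Q = 2 * U - 2 * (1 - c) * U\<^sup>2 + d * (c * R - (1 - s) * U)"
  define h where "h = 1 - 5 * c\<^sup>2 + 6 * c ^ 3 + (1 - c\<^sup>2) * ((5 * c - 2) * x' + (1 - c) * x'\<^sup>2)"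
  have h: "h \<ge> 0"
    unfolding h_def using c c1 x'1 U1' dx'
    by (intro third_fourth_coeff_inequality_real) (auto simp: d_def)
  define K where "K = 9 * c ^ 3 * d + c * U\<^sup>2 + 9 * c ^ 5 + 6 * c\<^sup>2 * U"
  have K: "K \<ge> 0" using c d U1' by (simp add: K_def)
  have Ux': "U = 3 * c\<^sup>2 + d * x'" using dx' by simp
  \<comment> \<open>Fixing the modulus \<open>U\<close> eliminates \<open>s\<close>, which becomes
    affine in \<open>t\<close>.\<close>
  have ds: "d * s = 6 * c\<^sup>2 * (x' - t) + d * x'\<^sup>2"
  proof -
    have "d * (d * s) = d * (6 * c\<^sup>2 * (x' - t) + d * x'\<^sup>2)"
      using Usq unfolding Ux' by (simp add: power2_eq_square power4_eq_xxxx algebra_simps)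
    then show ?thesis using d by simp
  qed
  have "Q = 2 * U - 2 * (1 - c) * U\<^sup>2 + c * (9 * c\<^sup>2 * d * t - 6 * c\<^sup>2 * d * t\<^sup>2
      + 3 * c\<^sup>2 * (d * s) + d * (d * s) * (3 - t)) - d * U + (d * s) * U"
    unfolding Q_def Rval by (simp add: algebra_simps)
  also have "\<dots> = U * h + K * (x' - t)"
    unfolding ds h_def K_def unfolding Ux' d_def by algebra
  also have "\<dots> \<ge> 0" using h K tx' U1' by simp
  finally have Q: "Q \<ge> 0" .
  define w where "w = 4 * c * u + 2 * d * (c * x * (3 - x) + (1 - (cmod x)\<^sup>2) * y)"
  have "4 * c * U\<^sup>2 + 2 * d * c * R - 2 * d * (1 - s) * U \<le> Re (w * cnj u)"
  proof -
    have "w * cnj u = of_real (4 * c) * (u * cnj u) + of_real (2 * d * c) * (x * (3 - x) * cnj u)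
        + of_real (2 * d * (1 - s)) * (y * cnj u)"
      by (simp add: w_def s_def algebra_simps)
    moreover have "u * cnj u = of_real (U\<^sup>2)"
      unfolding U_def by (rule complex_norm_square[symmetric])
    ultimately have "Re (w * cnj u) = 4 * c * U\<^sup>2 + 2 * d * c * R + 2 * d * (1 - s) * Re (y * cnj u)"
      by (simp add: R_def del: of_real_mult of_real_power flip: of_real_mult)
    moreover have "- U \<le> Re (y * cnj u)"
    proof -
      have "\<bar>Re (y * cnj u)\<bar> \<le> cmod y * U"
        using abs_Re_le_cmod[of "y * cnj u"] by (simp add: norm_mult U_def)
      also have "\<dots> \<le> 1 * U" using y U1' by (intro mult_right_mono) auto
      finally show ?thesis by simp
    qed
    then have "2 * d * (1 - s) * (- U) \<le> 2 * d * (1 - s) * Re (y * cnj u)"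
      using d s1 by (intro mult_left_mono) auto
    ultimately show ?thesis by simp
  qed
  moreover have "Re (w * cnj u) \<le> cmod w * U"
    using complex_Re_le_cmod[of "w * cnj u"] by (simp add: norm_mult U_def)
  \<comment> \<open>\<open>Q\<close> is half the margin between the lower bound for Re (w cnj u) and
    the target (4U - 4)U.\<close>
  moreover have "(4 * U - 4) * U = 4 * c * U\<^sup>2 + 2 * d * c * R - 2 * d * (1 - s) * U - 2 * Q"
    unfolding Q_def by algebra
  ultimately have "(4 * U - 4) * U \<le> cmod w * U" using Q by linarith
  then have "4 * U - 4 \<le> cmod w" using U1' by (simp only: mult_le_cancel_right)
  then show ?thesis by (simp add: U_def w_def)
qed

subsection \<open>The functions \<open>L \<phi>\<close>\<close>

lemma taylor_coeff_eq_fps_nth: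
  assumes "f has_fps_expansion F"
  shows "taylor_coeff f n = fps_nth F n"
  using fps_nth_fps_expansion[OF assms, of n] by (simp add: taylor_coeff_def)

context
  fixes \<phi> :: real
  assumes \<phi>: "0 < \<phi>" "\<phi> < pi"
begin

text \<open>Both logarithms have radius of convergence 1, and the difference of the n-th powers of
  \<open>cis \<phi>\<close> and \<open>cis (- \<phi>)\<close> is 2i sin(n phi). For phi strictly
  between 0 and pi the sine is positive, so \<open>L_coeff\<close> is in its generic case.\<close>

lemma L_closed_form:
  assumes z: "cmod z < 1"
  shows "(\<lambda>n. of_real (sin (real n * \<phi>) / (real n * sin \<phi>)) * z ^ n) sums
      ((Ln (1 - cis (- \<phi>) * z) - Ln (1 - cis \<phi> * z)) / (2 * \<i> * sin \<phi>))"
    and "L \<phi> z = (Ln (1 - cis (- \<phi>) * z) - Ln (1 - cis \<phi> * z)) / (2 * \<i> * sin \<phi>)"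
proof -
  have s: "sin \<phi> > 0" using \<phi> by (intro sin_gt_zero)
  have ln: "(\<lambda>n. - ((cis t * z) ^ n) / of_nat n) sums Ln (1 - cis t * z)" for t
    using Ln_series'[of "- (cis t * z)"] z by (simp add: norm_mult)
  have "(\<lambda>n. (- ((cis (- \<phi>) * z) ^ n) / of_nat n - - ((cis \<phi> * z) ^ n) / of_nat n) / (2 * \<i> * sin \<phi>)) sums
      ((Ln (1 - cis (- \<phi>) * z) - Ln (1 - cis \<phi> * z)) / (2 * \<i> * sin \<phi>))"
    by (intro sums_divide sums_diff ln)
  moreover have "(- ((cis (- \<phi>) * z) ^ n) / of_nat n - - ((cis \<phi> * z) ^ n) / of_nat n) / (2 * \<i> * sin \<phi>)
      = of_real (sin (real n * \<phi>) / (real n * sin \<phi>)) * z ^ n" for n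
  proof (cases "n = 0")
    case False
    have "cis (real n * \<phi>) - cis (- (real n * \<phi>)) = 2 * \<i> * sin (real n * \<phi>)"
      by (simp add: complex_eq_iff)
    then have "(cis \<phi>) ^ n - (cis (- \<phi>)) ^ n = 2 * \<i> * sin (real n * \<phi>)"
      by (simp add: Complex.DeMoivre)
    then have "(cis \<phi> * z) ^ n - (cis (- \<phi>) * z) ^ n = 2 * \<i> * sin (real n * \<phi>) * z ^ n"
      by (simp add: power_mult_distrib flip: left_diff_distrib)
    then show ?thesis using False s by (simp add: divide_simps)
  qed auto
  ultimately show 1: "(\<lambda>n. of_real (sin (real n * \<phi>) / (real n * sin \<phi>)) * z ^ n) sums
      ((Ln (1 - cis (- \<phi>) * z) - Ln (1 - cis \<phi> * z)) / (2 * \<i> * sin \<phi>))"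
    by simp
  \<comment> \<open>The index-0 term is 0, because 0 / 0 = 0, so the series may start at 1 as in the
    definition of \<open>L\<close>.\<close>
  then have "(\<lambda>n. of_real (sin (real (Suc n) * \<phi>) / (real (Suc n) * sin \<phi>)) * z ^ Suc n) sums
      ((Ln (1 - cis (- \<phi>) * z) - Ln (1 - cis \<phi> * z)) / (2 * \<i> * sin \<phi>))"
    by (subst sums_Suc_iff) simp
  then show "L \<phi> z = (Ln (1 - cis (- \<phi>) * z) - Ln (1 - cis \<phi> * z)) / (2 * \<i> * sin \<phi>)"
    using s by (simp add: L_def L_coeff_def sums_iff)
qed

lemma L_has_fps_expansion:
  "L \<phi> has_fps_expansion Abs_fps (\<lambda>n. of_real (sin (real n * \<phi>) / (real n * sin \<phi>)))"
proof (rule has_fps_expansionI)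
  have "eventually (\<lambda>z. z \<in> ball 0 1) (nhds (0::complex))"
    by (intro eventually_nhds_in_open) auto
  then show "eventually (\<lambda>z. (\<lambda>n. fps_nth (Abs_fps (\<lambda>n. of_real (sin (real n * \<phi>) / (real n * sin \<phi>)))) n * z ^ n)
      sums L \<phi> z) (nhds 0)"
    by eventually_elim (use L_closed_form in auto)
qed

lemma taylor_coeff_L: "taylor_coeff (L \<phi>) n = of_real (sin (real n * \<phi>) / (real n * sin \<phi>))"
  by (simp add: taylor_coeff_eq_fps_nth[OF L_has_fps_expansion])

text \<open>The Moebius map \<open>z \<mapsto> (1 - cis (- \<phi>) z) / (1 - cis \<phi> z)\<close> sends the disk to a half-plane
  bounded by a line through the origin, whose logarithm is a horizontal strip.\<close>
lemma L_image:
  "L \<phi> ` ball 0 1 = (\<lambda>W. W / (2 * \<i> * sin \<phi>)) ` {W. 0 < Im W + \<phi> \<and> Im W + \<phi> < pi}" (is ?image)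
  and inj_on_L: "inj_on (L \<phi>) (ball 0 1)"
  and holomorphic_L: "L \<phi> holomorphic_on ball 0 1"
proof -
  have s: "sin \<phi> > 0" using \<phi> by (intro sin_gt_zero)
  define W where "W z = Ln (1 - cis (- \<phi>) * z) - Ln (1 - cis \<phi> * z)" for z
  define S where "S = {W. 0 < Im W + \<phi> \<and> Im W + \<phi> < pi}"
  have pos: "Re (1 - cis t * z) > 0" if "cmod z < 1" for t z
  proof -
    have "Re (cis t * z) \<le> cmod (cis t * z)" by (rule complex_Re_le_cmod)
    then show ?thesis using that by (simp add: norm_mult)
  qed
  have nz: "1 - cis t * z \<noteq> 0" if "cmod z < 1" for t z
    using pos[OF that, of t] by (metis less_irrefl zero_complex.simps(1))
  have notin: "1 - cis t * z \<notin> \<real>\<^sub>\<le>\<^sub>0" if "z \<in> ball 0 1" for t z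
    using pos[of z t] that unfolding complex_nonpos_Reals_iff by auto
  have LW: "L \<phi> z = W z / (2 * \<i> * sin \<phi>)" if "cmod z < 1" for z
    using L_closed_form(2)[OF that] by (simp add: W_def)
  have "W holomorphic_on ball 0 1"
    unfolding W_def
    by (intro holomorphic_intros notin) auto
  then have "(\<lambda>z. W z / (2 * \<i> * sin \<phi>)) holomorphic_on ball 0 1"
    using s by (intro holomorphic_intros) auto
  then show "L \<phi> holomorphic_on ball 0 1"
    by (rule holomorphic_transform) (use LW in auto)
  have expW: "exp (W z) * (1 - cis \<phi> * z) = 1 - cis (- \<phi>) * z" if "cmod z < 1" for z
    using nz[OF that] by (simp add: W_def exp_diff)
  \<comment> \<open>Solving w = exp (W z) for z gives z = (w - 1)/(w cis phi - cis (-phi)). The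
    identity shows that |z| < 1 means Im (w cis phi) > 0.\<close>
  have half_plane: "(cmod (w * cis \<phi> - cis (- \<phi>)))\<^sup>2 - (cmod (w - 1))\<^sup>2 = 4 * sin \<phi> * Im (w * cis \<phi>)" for w
  proof -
    have "(cmod (w * cis \<phi> - cis (- \<phi>)))\<^sup>2 - (cmod (w - 1))\<^sup>2
      = (Re w * cos \<phi> - Im w * sin \<phi> - cos \<phi>)\<^sup>2 + (Re w * sin \<phi> + Im w * cos \<phi> + sin \<phi>)\<^sup>2
        - ((Re w - 1)\<^sup>2 + (Im w)\<^sup>2)"
      unfolding cmod_power2 by simp
    also have "\<dots> = 4 * sin \<phi> * (Re w * sin \<phi> + Im w * cos \<phi>)"
      using sin_cos_squared_add[of \<phi>] by algebra
    finally show ?thesis by simp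
  qed
  have sinpos: "Im (exp v * cis \<phi>) = exp (Re v) * sin (Im v + \<phi>)" for v
    by (simp add: Im_exp Re_exp sin_add algebra_simps)
  have WS: "W z \<in> S" if z: "cmod z < 1" for z
  proof -
    define w where "w = exp (W z)"
    have w: "(w * cis \<phi> - cis (- \<phi>)) * z = w - 1"
      using expW[OF z] unfolding w_def by (simp add: algebra_simps)
    have "w * cis \<phi> - cis (- \<phi>) \<noteq> 0"
    proof
      assume 0: "w * cis \<phi> - cis (- \<phi>) = 0"
      then have "w = 1" using w by simp
      then show False using 0 s by (auto simp: complex_eq_iff)
    qed
    then have "cmod (w - 1) < cmod (w * cis \<phi> - cis (- \<phi>))"
      using z unfolding w[symmetric] norm_mult by simp
    then have "(cmod (w - 1))\<^sup>2 < (cmod (w * cis \<phi> - cis (- \<phi>)))\<^sup>2"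
      by (intro power_strict_mono) auto
    then have "4 * sin \<phi> * Im (w * cis \<phi>) > 0"
      using half_plane[of w] by linarith
    then have "Im (w * cis \<phi>) > 0"
      using s by (simp only: zero_less_mult_iff) auto
    then have sn: "sin (Im (W z) + \<phi>) > 0"
      unfolding w_def sinpos by (simp add: zero_less_mult_iff)
    \<comment> \<open>Both logarithms are taken in the right half-plane, so Im W + phi lies in (-pi,
      2 pi), where the sine is positive only on (0, pi).\<close>
    have im: "\<bar>Im (Ln (1 - cis t * z))\<bar> < pi / 2" for t
      using Re_Ln_pos_lt[OF nz[OF z, of t]] pos[OF z, of t] by simp
    have "\<bar>Im (W z)\<bar> < pi"
      using im[of \<phi>] im[of "- \<phi>"] unfolding W_def by simp
    then have b: "- pi < Im (W z) + \<phi>" "Im (W z) + \<phi> < 2 * pi" using \<phi> by auto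
    have "0 < Im (W z) + \<phi>"
    proof (rule ccontr)
      assume "\<not> ?thesis"
      then have "sin (- (Im (W z) + \<phi>)) \<ge> 0" using b by (intro sin_ge_zero) auto
      with sn show False by (simp only: sin_minus)
    qed
    moreover have "Im (W z) + \<phi> < pi"
    proof (rule ccontr)
      assume "\<not> ?thesis"
      then have "sin (Im (W z) + \<phi> - pi) \<ge> 0" using b by (intro sin_ge_zero) auto
      with sn show False by simp
    qed
    ultimately show ?thesis by (simp add: S_def)
  qed
  have SW: "\<exists>z. cmod z < 1 \<and> W z = v" if v: "v \<in> S" for v
  proof -
    define w where "w = exp v"
    have "Im (w * cis \<phi>) > 0"
      unfolding w_def sinpos using v by (intro mult_pos_pos sin_gt_zero) (auto simp: S_def)
    then have "4 * sin \<phi> * Im (w * cis \<phi>) > 0" using s by simp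
    then have "(cmod (w - 1))\<^sup>2 < (cmod (w * cis \<phi> - cis (- \<phi>)))\<^sup>2"
      using half_plane[of w] by linarith
    then have lt: "cmod (w - 1) < cmod (w * cis \<phi> - cis (- \<phi>))"
      by (rule power_less_imp_less_base) simp
    then have nz': "w * cis \<phi> - cis (- \<phi>) \<noteq> 0" by (metis norm_ge_zero norm_zero not_le)
    define z where "z = (w - 1) / (w * cis \<phi> - cis (- \<phi>))"
    have z: "cmod z < 1" using lt nz' by (simp add: z_def norm_divide divide_simps)
    have "(w * cis \<phi> - cis (- \<phi>)) * z = w - 1" using nz' by (simp add: z_def)
    then have "w * (1 - cis \<phi> * z) = 1 - cis (- \<phi>) * z" by algebra
    then have "exp (W z) = exp v"
      using expW[OF z] nz[OF z, of \<phi>] unfolding w_def by (metis mult_right_cancel)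
    \<comment> \<open>Both points lie in a strip of width pi, less than the period of exp, so equal
      exponentials force equality.\<close>
    moreover have "\<bar>Im (W z) - Im v\<bar> < 2 * pi"
      using WS[OF z] v unfolding S_def mem_Collect_eq abs_less_iff by linarith
    ultimately have "W z = v" by (rule exp_complex_eqI[rotated])
    then show ?thesis using z by blast
  qed
  have "W ` ball 0 1 = S" using WS SW by force
  moreover have "L \<phi> ` ball 0 1 = (\<lambda>W. W / (2 * \<i> * sin \<phi>)) ` (W ` ball 0 1)"
    unfolding image_image using LW by (intro image_cong) auto
  ultimately show ?image by (simp add: S_def)
  show "inj_on (L \<phi>) (ball 0 1)"
  proof (rule inj_onI)
    fix x y :: complex assume xy: "x \<in> ball 0 1" "y \<in> ball 0 1" "L \<phi> x = L \<phi> y"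
    then have "W x = W y" using LW s by simp
    \<comment> \<open>exp W is a Moebius quotient; cross-multiplying two equal values leaves its
      nonzero determinant times x - y.\<close>
    have "(1 - cis (- \<phi>) * x) * (1 - cis \<phi> * y) = exp (W x) * (1 - cis \<phi> * x) * (1 - cis \<phi> * y)"
      using expW[of x] xy by simp
    also have "\<dots> = exp (W y) * (1 - cis \<phi> * y) * (1 - cis \<phi> * x)"
      by (simp add: \<open>W x = W y\<close>)
    also have "\<dots> = (1 - cis (- \<phi>) * y) * (1 - cis \<phi> * x)"
      using expW[of y] xy by simp
    finally have "(cis \<phi> - cis (- \<phi>)) * (x - y) = 0" by algebra
    moreover have "cis \<phi> - cis (- \<phi>) \<noteq> 0" using s by (simp add: complex_eq_iff)
    ultimately show "x = y" by simp
  qed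
qed

lemma L_in_class_K: "L \<phi> \<in> class_K"
proof -
  have s: "sin \<phi> > 0" using \<phi> by (intro sin_gt_zero)
  have "convex {W. 0 < Im W + \<phi> \<and> Im W + \<phi> < pi}"
  proof -
    have "{W. 0 < Im W + \<phi> \<and> Im W + \<phi> < pi} = {W. - \<phi> < Im W} \<inter> {W. Im W < pi - \<phi>}" by auto
    then show ?thesis by (simp add: convex_Int convex_halfspace_Im_gt convex_halfspace_Im_lt)
  qed
  then have "convex (L \<phi> ` ball 0 1)"
    unfolding L_image divide_inverse mult.commute[of _ "inverse _"]
    by (intro convex_linear_image bounded_linear.linear bounded_linear_mult_right)
  moreover have "L \<phi> 0 = 0" "deriv (L \<phi>) 0 = 1"
    using taylor_coeff_L[of 0] taylor_coeff_L[of 1] s by (simp_all add: taylor_coeff_def)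
  ultimately show ?thesis
    using inj_on_L holomorphic_L by (simp add: class_K_def class_S_def)
qed

end

subsection \<open>Coefficients of convex functions\<close>

text \<open>By convexity the midpoint lies in the image, so composing with the inverse of
  \<open>f\<close> gives a holomorphic self-map of the disk fixing 0; the Schwarz lemma applies to
  it.\<close>

lemma convex_midpoint_bound:
  assumes f: "f \<in> class_K" and z: "cmod z < 1" and a: "cmod a = 1" and b: "cmod b = 1"
  shows "\<exists>w. cmod w \<le> cmod z \<and> f w = (f (a * z) + f (b * z)) / 2"
proof -
  have holf: "f holomorphic_on ball 0 1" and inj: "inj_on f (ball 0 1)" and f0: "f 0 = 0"
    and conv: "convex (f ` ball 0 1)"
    using f by (auto simp: class_K_def class_S_def)
  obtain g where g: "g holomorphic_on f ` ball 0 1" "\<And>z. z \<in> ball 0 1 \<Longrightarrow> g (f z) = z"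
    using holomorphic_has_inverse[OF holf open_ball inj] by metis
  define m where "m v = (f (a * v) + f (b * v)) / 2" for v
  define W where "W v = g (m v)" for v
  have ab: "cmod (a * v) < 1" "cmod (b * v) < 1" if "cmod v < 1" for v
    using that a b by (simp_all add: norm_mult)
  have mem: "m v \<in> f ` ball 0 1" if "cmod v < 1" for v
  proof -
    have "(1/2) *\<^sub>R f (a * v) + (1/2) *\<^sub>R f (b * v) \<in> f ` ball 0 1"
      using ab[OF that] by (intro convexD[OF conv]) auto
    then show ?thesis by (simp add: m_def scaleR_conv_of_real add_divide_distrib)
  qed
  have fW: "f (W v) = m v" and W1: "cmod (W v) < 1" if "cmod v < 1" for v
    using mem[OF that] g(2) by (auto simp: W_def)
  have "(\<lambda>v. f (a * v)) holomorphic_on ball 0 1" "(\<lambda>v. f (b * v)) holomorphic_on ball 0 1"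
    using ab by (auto intro!: holomorphic_intros holomorphic_on_compose_gen[OF _ holf, unfolded o_def])
  then have "m holomorphic_on ball 0 1"
    unfolding m_def by (intro holomorphic_intros) auto
  then have holW: "W holomorphic_on ball 0 1"
    unfolding W_def using mem by (auto intro!: holomorphic_on_compose_gen[OF _ g(1), unfolded o_def])
  have "W 0 = 0" using g(2)[of 0] f0 by (simp add: W_def m_def)
  then have "cmod (W z) \<le> cmod z" using Schwarz_Lemma(1)[OF holW _ W1 z] by simp
  then show ?thesis using fW[OF z] by (auto simp: m_def)
qed

lemma second_order_remainder:
  fixes f :: "complex \<Rightarrow> complex"
  assumes "f holomorphic_on S" "open S" "z \<in> S"
  obtains q where "isCont q 0" "q 0 = deriv (deriv f) z / 2"
    "\<And>u. f (z + u) = f z + deriv f z * u + u\<^sup>2 * q u"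
proof -
  define F where "F = fps_expansion f z"
  have F: "(\<lambda>u. f (z + u)) has_fps_expansion F"
    unfolding F_def using assms
    by (intro analytic_at_imp_has_fps_expansion) (auto simp: analytic_at)
  have nth: "fps_nth F 0 = f z" "fps_nth F 1 = deriv f z" "fps_nth F 2 = deriv (deriv f) z / 2"
    by (simp_all add: F_def fps_expansion_def numeral_2_eq_2)
  \<comment> \<open>Adding \<open>c * u ^ 2\<close> makes the second coefficient 1. The corrected
    series is then nonzero even for affine \<open>f\<close>, so its subdegree is really 2;
    \<open>c\<close> is subtracted again at the end.\<close>
  define c where "c = 1 - deriv (deriv f) z / 2"
  define F' where "F' = F - fps_const (f z) - fps_const (deriv f z) * fps_X + fps_const c * fps_X ^ 2"
  define q where "q u = (if u = 0 then 1 else (f (z + u) - f z - deriv f z * u + c * u ^ 2) / u ^ 2)" for u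
  have F': "(\<lambda>u. f (z + u) - f z - deriv f z * u + c * u ^ 2) has_fps_expansion F'"
    unfolding F'_def by (intro fps_expansion_intros F)
  have F'2: "fps_nth F' 2 = 1"
    using nth by (simp add: F'_def c_def fps_X_power_nth)
  have "q has_fps_expansion fps_shift 2 F'"
    unfolding q_def
  proof (rule has_fps_expansion_shift[OF F'])
    have "fps_nth F' i = 0" if "i < 2" for i
      using that nth by (auto simp: F'_def less_2_cases_iff)
    then show "2 \<le> subdegree F'"
      using F'2 by (intro subdegree_geI) auto
  qed (simp add: F'2)
  then have "isCont q 0"
    using has_fps_expansion_imp_continuous by fastforce
  then have "isCont (\<lambda>u. q u - c) 0"
    by (intro continuous_intros)
  moreover have "f (z + u) = f z + deriv f z * u + u\<^sup>2 * (q u - c)" for u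
    by (simp add: q_def field_simps)
  ultimately show ?thesis
    using that[of "\<lambda>u. q u - c"] by (simp add: q_def c_def)
qed

text \<open>Expand the point \<open>w\<close> with \<open>f w = (f (z cis s) + f (z cis (-s))) / 2\<close> to second order in \<open>s\<close>;
  by the Schwarz lemma \<open>w\<close> stays in the disk of radius \<open>|z|\<close>.\<close>
lemma convex_Re_nonneg:
  assumes f: "f \<in> class_K" and z: "cmod z < 1"
  shows "deriv f z \<noteq> 0" and "Re (1 + z * deriv (deriv f) z / deriv f z) \<ge> 0"
proof -
  have holf: "f holomorphic_on ball 0 1" and inj: "inj_on f (ball 0 1)"
    using f by (auto simp: class_K_def class_S_def)
  show f': "deriv f z \<noteq> 0"
    using holomorphic_injective_imp_regular[OF holf open_ball inj] z by simp
  show "Re (1 + z * deriv (deriv f) z / deriv f z) \<ge> 0"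
  proof (cases "z = 0")
    case False
    obtain g where g: "\<And>z. z \<in> ball 0 1 \<Longrightarrow> g (f z) = z"
      using holomorphic_has_inverse[OF holf open_ball inj] by metis
    have "(g has_field_derivative inverse (deriv f z)) (at (f z))"
      by (rule has_field_derivative_inverse_strong[where S = "ball 0 1", OF _ f'])
        (use z g holf in \<open>auto intro: holomorphic_derivI[OF holf open_ball] holomorphic_on_imp_continuous_on\<close>)
    \<comment> \<open>Caratheodory's form of the derivative of the inverse: \<open>k\<close> is
      continuous at \<open>f z\<close>, so the limit along \<open>m s\<close> needs no exclusion of
      \<open>m s = f z\<close>.\<close>
    then obtain k where k: "\<And>w. g w - g (f z) = k w * (w - f z)" "isCont k (f z)" "k (f z) = inverse (deriv f z)"
      unfolding CARAT_DERIV by auto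
    obtain q where q: "isCont q 0" "q 0 = deriv (deriv f) z / 2"
      "\<And>u. f (z + u) = f z + deriv f z * u + u\<^sup>2 * q u"
      by (rule second_order_remainder[OF holf open_ball, of z]) (use z in auto)
    define m where "m s = (f (cis s * z) + f (cis (- s) * z)) / 2" for s
    define A where "A e s = (cis (e * s) - 1) / of_real s" for e s :: real
    have A: "(A e \<longlongrightarrow> of_real e * \<i>) (at 0)" for e
    proof -
      have "((\<lambda>s. cis (e * s)) has_vector_derivative of_real e * \<i>) (at 0)"
        using exp_scaleR_has_vector_derivative_right[of "of_real e * \<i>" 0]
        by (simp add: cis_conv_exp scaleR_conv_of_real mult_ac)
      then have "(\<lambda>s. cmod (cis (e * s) - 1 - s *\<^sub>R (of_real e * \<i>)) / \<bar>s\<bar>) \<midarrow>0\<rightarrow> 0"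
        unfolding has_vector_derivative_def has_derivative_at by simp
      then have "(\<lambda>s. cmod (A e s - of_real e * \<i>)) \<midarrow>0\<rightarrow> 0"
      proof (rule Lim_transform_eventually)
        have "cmod (cis (e * s) - 1 - s *\<^sub>R (of_real e * \<i>)) / \<bar>s\<bar> = cmod (A e s - of_real e * \<i>)" if "s \<noteq> 0" for s
        proof -
          have "A e s - of_real e * \<i> = (cis (e * s) - 1 - s *\<^sub>R (of_real e * \<i>)) / of_real s"
            using that by (simp add: A_def scaleR_conv_of_real field_simps)
          then show ?thesis by (simp add: norm_divide)
        qed
        then show "eventually (\<lambda>s. cmod (cis (e * s) - 1 - s *\<^sub>R (of_real e * \<i>)) / \<bar>s\<bar> = cmod (A e s - of_real e * \<i>)) (at 0)"
          by (auto simp: eventually_at_filter)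
      qed
      then show ?thesis by (rule LIM_zero_cancel[OF tendsto_norm_zero_cancel])
    qed
    have Q: "((\<lambda>s. q (z * (cis (e * s) - 1))) \<longlongrightarrow> q 0) (at 0)" for e :: real
    proof (rule isCont_tendsto_compose[OF q(1)])
      have "((\<lambda>s. z * (cis (e * s) - 1)) \<longlongrightarrow> z * (cis (e * 0) - 1)) (at 0)"
        by (intro tendsto_intros)
      then show "((\<lambda>s. z * (cis (e * s) - 1)) \<longlongrightarrow> 0) (at 0)" by simp
    qed
    \<comment> \<open>The s^2 coefficient of \<open>m\<close>: half the second derivative of f(z cis
      s) at s = 0.\<close>
    define c where "c = (- (deriv (deriv f) z * z\<^sup>2) - z * deriv f z) / 2"
    define Y where "Y s = z\<^sup>2 * (q (z * (cis (1 * s) - 1)) * (A 1 s)\<^sup>2 + q (z * (cis (-1 * s) - 1)) * (A (-1) s)\<^sup>2)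
        - deriv f z * z * A 1 s * A (-1) s" for s
    define X where "X s = Y s / 2" for s
    have m_quot: "X s = (m s - f z) / (of_real s)\<^sup>2" if "s \<noteq> 0" for s
    proof -
      have 1: "f (cis t * z) = f z + deriv f z * (z * (cis t - 1)) + (z * (cis t - 1))\<^sup>2 * q (z * (cis t - 1))" for t
        using q(3)[of "z * (cis t - 1)"] by (simp add: algebra_simps)
      \<comment> \<open>Hence (cis s - 1) + (cis (-s) - 1) = -(cis s - 1)(cis (-s) - 1): the
        first-order terms combine to order s^2.\<close>
      have 2: "cis s * cis (-s) = 1" by (simp add: cis_mult)
      have "2 * (m s - f z) = z\<^sup>2 * (q (z * (cis s - 1)) * (cis s - 1)\<^sup>2 + q (z * (cis (-s) - 1)) * (cis (-s) - 1)\<^sup>2)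
        - deriv f z * z * (cis s - 1) * (cis (-s) - 1)"
        unfolding m_def 1 using 2 by simp algebra
      moreover have 3: "cis s - 1 = A 1 s * of_real s" "cis (-s) - 1 = A (-1) s * of_real s"
        using that by (simp_all add: A_def)
      ultimately have "2 * (m s - f z) = Y s * (of_real s)\<^sup>2"
        unfolding Y_def by (simp add: algebra_simps power2_eq_square)
      then show ?thesis using that by (simp add: X_def field_simps)
    qed
    have "(X \<longlongrightarrow> (z\<^sup>2 * (q 0 * (of_real 1 * \<i>)\<^sup>2 + q 0 * (of_real (-1) * \<i>)\<^sup>2)
        - deriv f z * z * (of_real 1 * \<i>) * (of_real (-1) * \<i>)) / 2) (at 0)"
      unfolding X_def Y_def by (intro tendsto_intros A Q) auto
    then have "(X \<longlongrightarrow> c) (at 0)"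
      by (simp add: c_def q(2) power_mult_distrib algebra_simps)
    then have mlim: "((\<lambda>s. (m s - f z) / (of_real s)\<^sup>2) \<longlongrightarrow> c) (at 0)"
      by (rule Lim_transform_eventually) (use m_quot in \<open>auto simp: eventually_at_filter\<close>)
    have "((\<lambda>s. (m s - f z) / (of_real s)\<^sup>2 * (of_real s)\<^sup>2) \<longlongrightarrow> c * (of_real 0)\<^sup>2) (at 0)"
      by (intro tendsto_intros mlim)
    then have "((\<lambda>s. (m s - f z) / (of_real s)\<^sup>2 * (of_real s)\<^sup>2) \<longlongrightarrow> 0) (at 0)"
      by simp
    then have "((\<lambda>s. m s - f z) \<longlongrightarrow> 0) (at 0)"
      by (rule Lim_transform_eventually) (auto simp: eventually_at_filter)
    then have "(m \<longlongrightarrow> f z) (at 0)" by (simp add: LIM_zero_iff)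
    then have klim: "((\<lambda>s. k (m s)) \<longlongrightarrow> inverse (deriv f z)) (at 0)"
      using isCont_tendsto_compose[OF k(2)] k(3) by simp
    \<comment> \<open>Normalised so that the midpoint's preimage is w = z (1 + s^2 D s). Then |w| <=
      |z| gives Re (D s) <= 0, and the limit of \<open>D\<close> is -(1 + z f''/f')/2.\<close>
    define D where "D s = k (m s) * ((m s - f z) / (of_real s)\<^sup>2) / z" for s
    have "(D \<longlongrightarrow> inverse (deriv f z) * c / z) (at 0)"
      unfolding D_def by (intro tendsto_intros klim mlim False)
    then have "((\<lambda>s. Re (D s)) \<longlongrightarrow> Re (inverse (deriv f z) * c / z)) (at 0)"
      by (rule tendsto_Re)
    moreover have "Re (D s) \<le> 0" if s: "s \<noteq> 0" for s
    proof -
      obtain w where w: "cmod w \<le> cmod z" "f w = m s"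
        using convex_midpoint_bound[OF f z, of "cis s" "cis (-s)"] by (auto simp: m_def)
      have "w - z = k (m s) * (m s - f z)"
        using k(1)[of "m s"] g[of w] g[of z] w z by simp
      also have "\<dots> = z * (of_real (s\<^sup>2) * D s)"
        using s False by (simp add: D_def)
      finally have "w = z * (1 + of_real (s\<^sup>2) * D s)"
        by (simp add: algebra_simps)
      then have "cmod z * cmod (1 + of_real (s\<^sup>2) * D s) \<le> cmod z * 1"
        using w(1) by (simp add: norm_mult)
      then have "cmod (1 + of_real (s\<^sup>2) * D s) \<le> 1"
        by (rule mult_left_le_imp_le) (use False in simp)
      then have "Re (1 + of_real (s\<^sup>2) * D s) \<le> 1"
        using complex_Re_le_cmod order_trans by blast
      then have "s\<^sup>2 * Re (D s) \<le> 0" by simp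
      then show ?thesis using s by (simp add: mult_le_0_iff)
    qed
    then have "eventually (\<lambda>s. Re (D s) \<le> 0) (at 0)"
      by (auto simp: eventually_at_filter)
    ultimately have "Re (inverse (deriv f z) * c / z) \<le> 0"
      by (intro tendsto_upperbound) auto
    moreover have "inverse (deriv f z) * c / z = - (1 + z * deriv (deriv f) z / deriv f z) / 2"
      using f' False by (simp add: c_def field_simps power2_eq_square)
    ultimately show ?thesis by simp
  qed auto
qed

section \<open>Power series of the derivative: recursion and parametrisation of the
  coefficients\<close>

lemma fps_nth_expansion_deriv:
  "fps_nth (fps_expansion (deriv f) 0) n = of_nat (Suc n) * taylor_coeff f (Suc n)"
proof -
  have "of_nat (Suc n) \<noteq> (0 :: complex)" by (simp del: of_nat_Suc)
  moreover have "of_nat (fact (Suc n)) = of_nat (Suc n) * (fact n :: complex)"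
    by (simp only: fact_Suc of_nat_mult of_nat_fact of_nat_id)
  ultimately show ?thesis
    by (simp add: fps_expansion_def taylor_coeff_def funpow_swap1 del: of_nat_Suc fact_Suc of_nat_fact)
qed

text \<open>The product form of p = 1 + z f''/f' as an identity of formal power series: comparing
  coefficients determines those of f' recursively from those of \<open>p\<close>.\<close>

lemma class_K_expansion:
  assumes f: "f \<in> class_K"
  obtains p where "p holomorphic_on ball 0 1" "\<And>z. cmod z < 1 \<Longrightarrow> Re (p z) \<ge> 0" "p 0 = 1"
    "fps_X * fps_deriv (fps_expansion (deriv f) 0) = (fps_expansion p 0 - 1) * fps_expansion (deriv f) 0"
proof -
  have holf: "f holomorphic_on ball 0 1"
    using f by (auto simp: class_K_def class_S_def)
  have hol1: "deriv f holomorphic_on ball 0 1" and hol2: "deriv (deriv f) holomorphic_on ball 0 1"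
    by (auto intro: holomorphic_deriv holf)
  define p where "p z = 1 + z * deriv (deriv f) z / deriv f z" for z
  have holp: "p holomorphic_on ball 0 1"
    unfolding p_def using convex_Re_nonneg(1)[OF f] by (intro holomorphic_intros hol1 hol2) auto
  have "fps_X * fps_deriv (fps_expansion (deriv f) 0) = (fps_expansion p 0 - 1) * fps_expansion (deriv f) 0"
  proof (rule eq_on_ball_imp_fps_eq)
    show "(\<lambda>z. z * deriv (deriv f) z) has_fps_expansion fps_X * fps_deriv (fps_expansion (deriv f) 0)"
      by (intro fps_expansion_intros holomorphic_has_fps_expansion_0 hol1)
    show "(\<lambda>z. (p z - 1) * deriv f z) has_fps_expansion (fps_expansion p 0 - 1) * fps_expansion (deriv f) 0"
      by (intro fps_expansion_intros holomorphic_has_fps_expansion_0 hol1 holp)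
    show "z * deriv (deriv f) z = (p z - 1) * deriv f z" if "cmod z < 1" for z
      using convex_Re_nonneg(1)[OF f that] by (simp add: p_def)
  qed
  then show ?thesis
    using convex_Re_nonneg(2)[OF f] by (intro that[OF holp]) (auto simp: p_def)
qed

text \<open>For B = (1 - zeta z) f' the logarithmic derivative z B'/B is P - Z with Z = 1/(1 - zeta
  z). Hence the numbers entering \<open>lebedev_milin\<close> are p_k - zeta^k, and the zeta of
  \<open>caratheodory_rotation\<close> makes the exponent nonpositive.\<close>

lemma successive_coeffs:
  assumes f: "f \<in> class_K"
  shows "\<exists>\<zeta>. cmod \<zeta> = 1 \<and>
    cmod (of_nat (Suc (Suc n)) * taylor_coeff f (Suc (Suc n)) - \<zeta> * (of_nat (Suc n) * taylor_coeff f (Suc n))) \<le> 1"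
proof -
  obtain p where p: "p holomorphic_on ball 0 1" "\<And>z. cmod z < 1 \<Longrightarrow> Re (p z) \<ge> 0" "p 0 = 1"
    and ode: "fps_X * fps_deriv (fps_expansion (deriv f) 0) = (fps_expansion p 0 - 1) * fps_expansion (deriv f) 0"
    by (rule class_K_expansion[OF f]) blast
  define P where "P = fps_expansion p 0"
  define F where "F = fps_expansion (deriv f) 0"
  obtain \<zeta> where \<zeta>: "cmod \<zeta> = 1"
    "(\<Sum>k\<le>n. ((cmod (fps_nth P (Suc k) - \<zeta> ^ Suc k))\<^sup>2 - 1) / real (Suc k)) \<le> 0"
    unfolding P_def by (rule caratheodory_rotation[OF p])
  define B where "B = (1 - fps_const \<zeta> * fps_X) * F"
  define Z where "Z = Abs_fps (\<lambda>k. \<zeta> ^ k)"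
  define A where "A = P - Z"
  have Z: "(1 - fps_const \<zeta> * fps_X) * Z = 1"
  proof (rule fps_ext)
    fix k show "fps_nth ((1 - fps_const \<zeta> * fps_X) * Z) k = fps_nth 1 k"
      by (cases k) (simp_all add: Z_def left_diff_distrib mult.assoc)
  qed
  have ode': "fps_X * fps_deriv F = (P - 1) * F"
    using ode by (simp only: F_def P_def)
  have "fps_X * fps_deriv B = (1 - fps_const \<zeta> * fps_X) * (fps_X * fps_deriv F) - fps_const \<zeta> * fps_X * F"
    by (simp add: B_def algebra_simps)
  also have "\<dots> = A * B + ((1 - fps_const \<zeta> * fps_X) * Z - 1) * F"
    unfolding ode' by (simp add: A_def B_def algebra_simps)
  finally have BA: "fps_X * fps_deriv B = A * B" by (simp add: Z)
  have A0: "fps_nth A 0 = 0" by (simp add: A_def P_def Z_def fps_expansion_def p(3))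
  have "deriv f 0 = 1" using f by (auto simp: class_K_def class_S_def)
  then have B0: "fps_nth B 0 = 1" by (simp add: B_def F_def fps_expansion_def)
  have "of_nat (Suc m) * fps_nth B (Suc m) = (\<Sum>k\<le>m. fps_nth A (Suc k) * fps_nth B (m - k))" for m
  proof -
    have "of_nat (Suc m) * fps_nth B (Suc m) = fps_nth (A * B) (Suc m)"
      unfolding BA[symmetric] by simp
    also have "\<dots> = (\<Sum>k\<le>Suc m. fps_nth A k * fps_nth B (Suc m - k))"
      by (simp add: fps_mult_nth atLeast0AtMost)
    also have "\<dots> = (\<Sum>k\<le>m. fps_nth A (Suc k) * fps_nth B (m - k))"
      by (subst sum.atMost_Suc_shift) (simp add: A0)
    finally show ?thesis .
  qed
  from lebedev_milin[of "fps_nth B" "fps_nth A", OF B0 this, of n]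
  have "(cmod (fps_nth B (Suc n)))\<^sup>2 \<le> exp (\<Sum>k\<le>n. ((cmod (fps_nth A (Suc k)))\<^sup>2 - 1) / real (Suc k))" .
  also have "\<dots> \<le> exp 0"
    using \<zeta>(2) by (simp add: A_def Z_def)
  finally have "cmod (fps_nth B (Suc n)) \<le> 1" by (simp add: power_le_one_iff)
  moreover have "fps_nth B (Suc n) = fps_nth F (Suc n) - \<zeta> * fps_nth F n"
    by (simp add: B_def left_diff_distrib mult.assoc)
  ultimately show ?thesis
    using \<zeta>(1) unfolding F_def fps_nth_expansion_deriv by auto
qed

text \<open>Rotating \<open>f\<close> changes no modulus of a coefficient, so the first Schur
  parameter may be taken to be a real c >= 0. The rotation is carried out on the parameters: a power
  of zeta factors out of each coefficient of f'.\<close>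

lemma convex_initial_coeffs:
  assumes f: "f \<in> class_K"
  obtains c :: real and x y :: complex where "0 \<le> c" "c \<le> 1" "cmod x \<le> 1" "cmod y \<le> 1"
    "cmod (taylor_coeff f 2) = c"
    "3 * cmod (taylor_coeff f 3) = cmod (3 * c\<^sup>2 + (1 - c\<^sup>2) * x)"
    "12 * cmod (taylor_coeff f 4) = cmod (4 * c * (3 * c\<^sup>2 + (1 - c\<^sup>2) * x)
        + 2 * (1 - c\<^sup>2) * (c * x * (3 - x) + (1 - (cmod x)\<^sup>2) * y))"
proof -
  obtain p where p: "p holomorphic_on ball 0 1" "\<And>z. cmod z < 1 \<Longrightarrow> Re (p z) \<ge> 0" "p 0 = 1"
    and ode: "fps_X * fps_deriv (fps_expansion (deriv f) 0) = (fps_expansion p 0 - 1) * fps_expansion (deriv f) 0"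
    by (rule class_K_expansion[OF f]) blast
  define P where "P = fps_nth (fps_expansion p 0)"
  define b where "b = fps_nth (fps_expansion (deriv f) 0)"
  obtain g x y :: complex where gxy: "cmod g \<le> 1" "cmod x \<le> 1" "cmod y \<le> 1"
    and P: "P 1 = 2 * g" "P 2 = 2 * g\<^sup>2 + 2 * (1 - (cmod g)\<^sup>2) * x"
    "P 3 = 2 * g ^ 3 + 4 * (1 - (cmod g)\<^sup>2) * g * x
       + 2 * (1 - (cmod g)\<^sup>2) * ((1 - (cmod x)\<^sup>2) * y - cnj g * x\<^sup>2)"
    unfolding P_def by (rule caratheodory_coeffs[OF p])
  have "deriv f 0 = 1" using f by (auto simp: class_K_def class_S_def)
  then have b0: "b 0 = 1" by (simp add: b_def fps_expansion_def)
  have P0: "P 0 = 1" by (simp add: P_def fps_expansion_def p(3))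
  have b1: "b 1 = P 1"
    using arg_cong[OF ode, of "\<lambda>h. fps_nth h 1"] b0 P0
    by (simp add: fps_mult_nth numeral_eq_Suc flip: P_def b_def)
  have b2: "2 * b 2 = P 1 * b 1 + P 2"
    using arg_cong[OF ode, of "\<lambda>h. fps_nth h 2"] b0 P0
    by (simp add: fps_mult_nth numeral_eq_Suc flip: P_def b_def)
  have b3: "3 * b 3 = P 1 * b 2 + P 2 * b 1 + P 3"
    using arg_cong[OF ode, of "\<lambda>h. fps_nth h 3"] b0 P0
    by (simp add: fps_mult_nth numeral_eq_Suc flip: P_def b_def)
  define c where "c = cmod g"
  \<comment> \<open>Also for \<open>g = 0\<close> this is unimodular, since
    \<open>Arg 0 = 0\<close>.\<close>
  define \<zeta> where "\<zeta> = cis (Arg g)"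
  have \<zeta>: "cmod \<zeta> = 1" "\<zeta> \<noteq> 0" by (simp_all add: \<zeta>_def)
  have g: "g = of_real c * \<zeta>"
    using rcis_cmod_Arg[of g] by (simp add: c_def \<zeta>_def rcis_def)
  have cg: "cnj g = of_real c / \<zeta>"
    unfolding g using \<zeta>(1) by (simp add: divide_conv_cnj)
  define x' where "x' = x / \<zeta>\<^sup>2"
  define y' where "y' = y / \<zeta> ^ 3"
  have nx': "cmod x' = cmod x" and ny': "cmod y' = cmod y"
    using \<zeta>(1) by (simp_all add: x'_def y'_def norm_divide norm_power)
  have x: "x = x' * \<zeta>\<^sup>2" and y: "y = y' * \<zeta> ^ 3"
    using \<zeta>(2) by (simp_all add: x'_def y'_def)
  define u where "u = 3 * of_real (c\<^sup>2) + of_real (1 - c\<^sup>2) * x'"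
  have B1: "b 1 = 2 * c * \<zeta>" unfolding b1 P(1) g by simp
  have "2 * b 2 = 2 * (\<zeta>\<^sup>2 * u)"
    unfolding b2 B1 P(1,2) unfolding c_def[symmetric] unfolding g x u_def
    by (simp add: algebra_simps power2_eq_square)
  then have B2: "b 2 = \<zeta>\<^sup>2 * u" by simp
  have cz: "cnj g * x\<^sup>2 = of_real c * x'\<^sup>2 * \<zeta> ^ 3"
    unfolding cg x using \<zeta>(2) by (simp add: field_simps power2_eq_square power3_eq_cube)
  have B3: "3 * b 3 = \<zeta> ^ 3 * (4 * c * u + 2 * (1 - c\<^sup>2) * (c * x' * (3 - x') + (1 - (cmod x')\<^sup>2) * y'))"
    unfolding b3 B1 B2 P(1,2,3) cz unfolding c_def[symmetric] nx'[symmetric] unfolding g u_def x y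
    by (simp add: algebra_simps power2_eq_square power3_eq_cube)
  have coeff: "b 1 = 2 * taylor_coeff f 2" "b 2 = 3 * taylor_coeff f 3" "b 3 = 4 * taylor_coeff f 4"
    unfolding b_def fps_nth_expansion_deriv by (simp_all add: numeral_eq_Suc)
  show ?thesis
  proof (rule that[of c x' y'])
    show "0 \<le> c" "c \<le> 1" "cmod x' \<le> 1" "cmod y' \<le> 1"
      using gxy by (simp_all add: c_def nx' ny')
    then have "cmod (2 * taylor_coeff f 2) = 2 * c"
      unfolding coeff[symmetric] B1 using \<zeta>(1) by (simp add: norm_mult)
    then show "cmod (taylor_coeff f 2) = c" by (simp add: norm_mult)
    have "cmod (3 * taylor_coeff f 3) = cmod u"
      unfolding coeff[symmetric] B2 using \<zeta>(1) by (simp add: norm_mult norm_power)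
    then show "3 * cmod (taylor_coeff f 3) = cmod (3 * c\<^sup>2 + (1 - c\<^sup>2) * x')"
      by (simp add: u_def norm_mult)
    have "cmod (3 * (4 * taylor_coeff f 4)) = cmod (4 * c * u + 2 * (1 - c\<^sup>2) * (c * x' * (3 - x') + (1 - (cmod x')\<^sup>2) * y'))"
      unfolding coeff[symmetric] B3 norm_mult norm_power using \<zeta>(1) by simp
    then show "12 * cmod (taylor_coeff f 4) = cmod (4 * c * (3 * c\<^sup>2 + (1 - c\<^sup>2) * x')
        + 2 * (1 - c\<^sup>2) * (c * x' * (3 - x') + (1 - (cmod x')\<^sup>2) * y'))"
      by (simp add: u_def norm_mult)
  qed
qed

section \<open>Bounds for differences of successive moduli, and their attainment\<close>

lemma convex_coeff_increase:
  assumes "f \<in> class_K" and n: "n \<ge> 1"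
  shows "cmod (taylor_coeff f (n + 1)) - cmod (taylor_coeff f n) \<le> 1 / real (n + 1)"
proof -
  obtain m where m: "n = Suc m" using n by (cases n) auto
  let ?a = "\<lambda>k. cmod (taylor_coeff f k)"
  obtain \<zeta> where \<zeta>: "cmod \<zeta> = 1"
    "cmod (of_nat (Suc (Suc m)) * taylor_coeff f (Suc (Suc m)) - \<zeta> * (of_nat (Suc m) * taylor_coeff f (Suc m))) \<le> 1"
    using successive_coeffs[OF assms(1)] by blast
  have "cmod (of_nat (n + 1) * taylor_coeff f (n + 1)) - cmod (\<zeta> * (of_nat n * taylor_coeff f n)) \<le> 1"
    using order_trans[OF norm_triangle_ineq2 \<zeta>(2)] by (simp only: m Suc_eq_plus1)
  then have "real (n + 1) * ?a (n + 1) - real n * ?a n \<le> 1"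
    unfolding norm_mult norm_of_nat using \<zeta>(1) by simp
  then have "(?a (n + 1) - ?a n) * real (n + 1) \<le> 1 - ?a n"
    by (simp add: algebra_simps)
  also have "\<dots> \<le> 1" by simp
  finally show ?thesis by (simp add: field_simps)
qed

text \<open>The reverse triangle inequality gives 3|a_3| >= 4c^2 - 1 with c = |a_2|. For c > 1/2 the
  claim reduces to (2c - 1)(4c - 1) >= 0; for smaller c it is trivial.\<close>

lemma convex_coeff_decrease_2:
  assumes f: "f \<in> class_K"
  shows "cmod (taylor_coeff f 2) - cmod (taylor_coeff f 3) \<le> 1 / 2"
proof -
  obtain c :: real and x y :: complex where c: "0 \<le> c" "c \<le> 1" "cmod x \<le> 1" "cmod (taylor_coeff f 2) = c"
    "3 * cmod (taylor_coeff f 3) = cmod (3 * c\<^sup>2 + (1 - c\<^sup>2) * x)"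
    by (rule convex_initial_coeffs[OF f]) blast
  have c2: "c\<^sup>2 \<le> 1" using c by (simp add: power_le_one)
  define N where "N = cmod (of_real (1 - c\<^sup>2) * x)"
  have "cmod (of_real (3 * c\<^sup>2)) - N \<le> 3 * cmod (taylor_coeff f 3)"
    unfolding c(5) N_def by (rule norm_diff_ineq[THEN order_trans]) simp
  then have "3 * c\<^sup>2 - N \<le> 3 * cmod (taylor_coeff f 3)"
    unfolding norm_of_real by simp
  moreover have "N \<le> (1 - c\<^sup>2) * 1"
    using c(3) c2 unfolding N_def norm_mult norm_of_real by (intro mult_mono) auto
  ultimately have a3: "4 * c\<^sup>2 - 1 \<le> 3 * cmod (taylor_coeff f 3)" by simp
  show ?thesis
  proof (cases "c \<le> 1/2")
    case False
    then have "0 \<le> (2 * c - 1) * (4 * c - 1)" by (intro mult_nonneg_nonneg) auto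
    then have "c - 1/2 \<le> (4 * c\<^sup>2 - 1) / 3" by (simp add: algebra_simps power2_eq_square)
    then show ?thesis using a3 c(4) by simp
  qed (use c(4) norm_ge_zero[of "taylor_coeff f 3"] in linarith)
qed

lemma convex_coeff_decrease_3:
  assumes f: "f \<in> class_K"
  shows "cmod (taylor_coeff f 3) - cmod (taylor_coeff f 4) \<le> 1 / 3"
proof -
  obtain c :: real and x y :: complex where c: "0 \<le> c" "c \<le> 1" "cmod x \<le> 1" "cmod y \<le> 1"
    "3 * cmod (taylor_coeff f 3) = cmod (3 * c\<^sup>2 + (1 - c\<^sup>2) * x)"
    "12 * cmod (taylor_coeff f 4) = cmod (4 * c * (3 * c\<^sup>2 + (1 - c\<^sup>2) * x)
        + 2 * (1 - c\<^sup>2) * (c * x * (3 - x) + (1 - (cmod x)\<^sup>2) * y))"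
    by (rule convex_initial_coeffs[OF f]) blast
  from third_fourth_coeff_inequality[OF c(1-4)] show ?thesis
    unfolding c(5,6)[symmetric] by simp
qed

text \<open>Serves all extremal cases: the n-th coefficient vanishes while its neighbours do not.
  The pair n, n + 1 gives the increase; the pair n - 1, n with n = 3 and n = 4 gives the two
  decreases.\<close>

lemma taylor_coeff_L_pi_div:
  fixes n :: nat
  assumes n: "n \<ge> 2"
  shows "cmod (taylor_coeff (L (pi / real n)) (n - 1)) = 1 / real (n - 1)"
    and "taylor_coeff (L (pi / real n)) n = 0"
    and "cmod (taylor_coeff (L (pi / real n)) (n + 1)) = 1 / real (n + 1)"
    and "L (pi / real n) \<in> class_K"
proof -
  have \<phi>: "0 < pi / real n" "pi / real n < pi" using n by (auto simp: divide_simps)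
  have s: "sin (pi / real n) > 0" using \<phi> by (intro sin_gt_zero)
  have "real (n - 1) * (pi / real n) = pi - pi / real n" "real (n + 1) * (pi / real n) = pi / real n + pi"
    "real n * (pi / real n) = pi"
    using n by (simp_all add: of_nat_diff field_simps)
  then have sins: "sin (real (n - 1) * (pi / real n)) = sin (pi / real n)"
    "sin (real (n + 1) * (pi / real n)) = - sin (pi / real n)" "sin (real n * (pi / real n)) = 0"
    by (simp_all only: sin_pi_minus sin_periodic_pi sin_pi)
  show "cmod (taylor_coeff (L (pi / real n)) (n - 1)) = 1 / real (n - 1)"
    "taylor_coeff (L (pi / real n)) n = 0"
    "cmod (taylor_coeff (L (pi / real n)) (n + 1)) = 1 / real (n + 1)"
    unfolding taylor_coeff_L[OF \<phi>] sins norm_of_real using s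
    by (simp_all add: abs_mult)
  show "L (pi / real n) \<in> class_K" by (rule L_in_class_K[OF \<phi>])
qed

theorem theorem1:
  shows "(\<forall>n::nat. n \<ge> 2 \<longrightarrow>
            (SUP f\<in>class_K. cmod (taylor_coeff f (n+1)) - cmod (taylor_coeff f n)) = 1 / real (n+1)
          \<and> L (pi / real n) \<in> class_K
          \<and> cmod (taylor_coeff (L (pi / real n)) (n+1)) - cmod (taylor_coeff (L (pi / real n)) n)
              = 1 / real (n+1))
       \<and> ((SUP f\<in>class_K. cmod (taylor_coeff f 2) - cmod (taylor_coeff f 3)) = 1/2
          \<and> L (pi/3) \<in> class_K
          \<and> cmod (taylor_coeff (L (pi/3)) 2) - cmod (taylor_coeff (L (pi/3)) 3) = 1/2)
       \<and> ((SUP f\<in>class_K. cmod (taylor_coeff f 3) - cmod (taylor_coeff f 4)) = 1/3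
          \<and> L (pi/4) \<in> class_K
          \<and> cmod (taylor_coeff (L (pi/4)) 3) - cmod (taylor_coeff (L (pi/4)) 4) = 1/3)"
proof (intro conjI allI impI)
  fix n :: nat assume n: "n \<ge> 2"
  then have n': "n \<ge> 1" by simp
  note L = taylor_coeff_L_pi_div[OF n]
  show val: "cmod (taylor_coeff (L (pi / real n)) (n + 1)) - cmod (taylor_coeff (L (pi / real n)) n) = 1 / real (n + 1)"
    by (simp only: L) simp
  show mem: "L (pi / real n) \<in> class_K" by (rule L)
  show "(SUP f\<in>class_K. cmod (taylor_coeff f (n + 1)) - cmod (taylor_coeff f n)) = 1 / real (n + 1)"
  \<comment> \<open>An attained upper bound is the supremum, which also settles boundedness and
    nonemptiness for the real \<open>SUP\<close>.\<close>
  proof (rule cSup_eq_maximum)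
    show "1 / real (n + 1) \<in> (\<lambda>f. cmod (taylor_coeff f (n + 1)) - cmod (taylor_coeff f n)) ` class_K"
      by (rule rev_image_eqI[OF mem]) (simp only: val)
  qed (elim imageE, simp only: convex_coeff_increase[OF _ n'])
next
  note L = taylor_coeff_L_pi_div[of 3, simplified]
  show val: "cmod (taylor_coeff (L (pi / 3)) 2) - cmod (taylor_coeff (L (pi / 3)) 3) = 1 / 2"
    using L by simp
  show mem: "L (pi / 3) \<in> class_K" by (rule L)
  show "(SUP f\<in>class_K. cmod (taylor_coeff f 2) - cmod (taylor_coeff f 3)) = 1 / 2"
  proof (rule cSup_eq_maximum)
    show "1 / 2 \<in> (\<lambda>f. cmod (taylor_coeff f 2) - cmod (taylor_coeff f 3)) ` class_K"
      by (rule rev_image_eqI[OF mem]) (simp only: val)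
  qed (elim imageE, simp only: convex_coeff_decrease_2)
next
  note L = taylor_coeff_L_pi_div[of 4, simplified]
  show val: "cmod (taylor_coeff (L (pi / 4)) 3) - cmod (taylor_coeff (L (pi / 4)) 4) = 1 / 3"
    using L by simp
  show mem: "L (pi / 4) \<in> class_K" by (rule L)
  show "(SUP f\<in>class_K. cmod (taylor_coeff f 3) - cmod (taylor_coeff f 4)) = 1 / 3"
  proof (rule cSup_eq_maximum)
    show "1 / 3 \<in> (\<lambda>f. cmod (taylor_coeff f 3) - cmod (taylor_coeff f 4)) ` class_K"
      by (rule rev_image_eqI[OF mem]) (simp only: val)
  qed (elim imageE, simp only: convex_coeff_decrease_3)
qed

end
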